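(* Let $\boldsymbol c^{p-1}\in(\mathbb R^n)^N$ satisfy $c^{p-1}_{i,K}\ge 0$ for all $i,K$ and $\sum_{i=1}^n c_{i,K}^{p-1}=1$ for all $K\in\{1,\dots,N\}$, let $X^{p-1}\in[0,1]$ be such that $1<K^{p-1}<N$, and assume that $\sum_{K=1}^N\Delta_K^{p-1}c_{i,K}^{p-1}>0$ for all $i\in\{1,\dots,n\}$. Then there exists a solution $(\boldsymbol c^{p,\star},X^p)$, with post-processed concentrations $\boldsymbol c^p$, of the scheme $(S)$ with the following properties. (a) For all $K$, $(\boldsymbol c_K^{p,\star})^\diamond=\boldsymbol c_K^{p,\star}$; moreover $\big(\sum_i c^{p,\star}_{i,K^{p-1}}\big)\boldsymbol F^{p,\star}=\big(\sum_i c^{p,\star}_{i,K^{p-1}+1}\big)\boldsymbol F^{p,\star}$; and for all $K^{p-1}<K\le N-1$ the Stefan–Maxwell matrix $\check{\widetilde{\boldsymbol A}}_g(\boldsymbol c^{p,\star}_{K+\frac12})$ is invertible. (b) $c^p_{i,K}>0$ for all $i,K$ (in particular $c^p_{i,K}\ge0$); $\sum_{i=1}^n c_{i,K}^p=1$ for all $K$; and $\sum_{K=1}^N\Delta_K^pc_{i,K}^p=\sum_{K=1}^N\Delta_K^{p-1}c_{i,K}^{p-1}$ for all $i$. (c) All $c^{p,\star}_{i,K}$ are positive (so that the logarithms are defined) and $$\mathcal H^p(\boldsymbol c^p,X^p)+\frac{\Delta t}{\Delta x}\sum_{1\le K\le N-1,\; K\ne K^{p-1}}\big(D_{K+\frac12}\log\boldsymbol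 c^{p,\star}\big)^T\,\widehat{\boldsymbol M}_{\alpha_K^{p-1}}(\boldsymbol c^{p,\star}_{K+\frac12})\,D_{K+\frac12}\log\boldsymbol c^{p,\star}$$ $$+\Delta t\sum_{i=1}^nF_i^{p,\star}\Big(\log c^{p,\star}_{i,K^{p-1}+1}+\mu_i^{*,g}-\log c^{p,\star}_{i,K^{p-1}}-\mu_i^{*,s}\Big)\le\mathcal H^{p-1}(\boldsymbol c^{p-1},X^{p-1}),$$ and in particular $\mathcal H^p(\boldsymbol c^p,X^p)\le\mathcal H^{p-1}(\boldsymbol c^{p-1},X^{p-1})$. Here the assertions involving the post-processed $\boldsymbol c^p$ (that is, (b) and the inequalities in (c)) are made when $1<K^p<N$, the case in which $\boldsymbol c^p$ is defined.
   Context: Parameters. $n\ge2$; $\mathcal A=\{\boldsymbol c\in\mathbb R_+^n:\sum_ic_i=1\}$. For $\alpha\in\{s,g\}$ (solid, gas) let $\kappa_{ij}^\alpha=\kappa_{ji}^\alpha>0$ for $i\neq j$, $\kappa^{*,\alpha}=\min_{i\ne j}\kappa^\alpha_{ij}>0$, $\bar\kappa^\alpha_{ij}=\kappa^\alpha_{ij}-\kappa^{*,\alpha}\ge0$ for $i\ne j$. For $\boldsymbol u\in\mathbb R^n$ let $\bar{\boldsymbol A}_\alpha(\boldsymbol u)\in\mathbb R^{n\times n}$ have entries $(\bar{\boldsymbol A}_\alpha)_{ii}(\boldsymbol u)=\sum_{j\ne i}\bar\kappa^\alpha_{ij}u_j$ and $(\bar{\boldsymbol A}_\alpha)_{ij}(\boldsymbol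 u)=-\bar\kappa^\alpha_{ij}u_i$ for $i\ne j$. Set $\widehat{\boldsymbol A}_s(\boldsymbol u)=\bar{\boldsymbol A}_s(\boldsymbol u)+\kappa^{*,s}\boldsymbol I$, $\check{\widetilde{\boldsymbol A}}_g(\boldsymbol u)=\bar{\boldsymbol A}_g(\boldsymbol u)+\kappa^{*,g}\boldsymbol I$ and, when the latter is invertible, $\widehat{\boldsymbol A}_g(\boldsymbol u)=\check{\widetilde{\boldsymbol A}}_g(\boldsymbol u)^{-1}$. Set $\widehat{\boldsymbol M}_\alpha(\boldsymbol u)=\widehat{\boldsymbol A}_\alpha(\boldsymbol u)\,\mathrm{diag}(u_1,\dots,u_n)$. Let $\boldsymbol\mu^{*,s},\boldsymbol\mu^{*,g}\in\mathbb R^n$ and $\beta_i^*=\exp(\mu_i^{*,g}-\mu_i^{*,s})$. Mesh. $N\in\mathbb N^*$, $\Delta x=1/N$, $x_{K+\frac12}=K\Delta x$ for $0\le K\le N$. For interface positions $X^{p-1},X^p\in[0,1]$, $K^{q}\in\{0,\dots,N\}$ ($q\in\{p-1,p\}$) denotes the lowest integer minimizing $K\mapsto|x_{K+\frac12}-X^{q}|$. Cell sizes: $\Delta^q_{K^q}=X^q-x_{K^q-\frac12}$, $\Delta^q_{K^q+1}=x_{K^q+\frac32}-X^q$, $\Delta^q_K=\Delta x$ otherwise. Intermediate cell sizes: $\Delta^{p,\star}_{K^{p-1}}=X^p-x_{K^{p-1}-\frac12}$, $\Delta^{p,\star}_{K^{p-1}+1}=x_{K^{p-1}+\frac32}-X^p$,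 $\Delta^{p,\star}_K=\Delta x$ otherwise. Standing assumption on the time step: $0<\Delta t<\Delta x/(2C)$ with $C=\max_i2\cosh\big(\tfrac12(\mu_i^{*,g}-\mu_i^{*,s})\big)$ (this gives $|X^p-X^{p-1}|<\Delta x/2$ and $|K^p-K^{p-1}|\le1$ when the cell concentrations $\boldsymbol c^{p,\star}_K$ lie in $\mathcal A$). Notation. For $\boldsymbol c=(c_{i,K})\in(\mathbb R^n)^N$, $\boldsymbol c_K=(c_{i,K})_i$ and $D_{K+\frac12}\boldsymbol d=\boldsymbol d_{K+1}-\boldsymbol d_K$; $\log$ is taken componentwise. Edge values $\boldsymbol c_{K+\frac12}=(c_{i,K+\frac12})_i$, $1\le K\le N-1$: $c_{i,K+\frac12}=0$ if $\min(c_{i,K},c_{i,K+1})\le0$; $=c_{i,K}$ if $0<c_{i,K}=c_{i,K+1}$; $=\frac{c_{i,K}-c_{i,K+1}}{\log c_{i,K}-\log c_{i,K+1}}$ otherwise. For $\boldsymbol x\in\mathbb R^n$, $\boldsymbol x^\diamond\in\mathbb R^n$ has components $x_i^\diamond=x_i^+/\max(1,\sum_jx_j^+)$, $x^+=\max(x,0)$. Scheme $(S)$ (one time step, $p\ge 1$). Given $(\boldsymbol c^{p-1},X^{p-1})$ with $1<K^{p-1}<N$, find $\boldsymbol c^{p,\star}\in(\mathbb R^n)^N$, $X^p\in[0,1]$ and fluxes $\boldsymbol J^{p,\star}_{K+\frac12}\in\mathbb R^n$, $0\le K\le N$, such that for all $i$ and $1\le K\le N$ $$\tfrac1{\Delta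 t}\big(\Delta_K^{p,\star}c^{p,\star}_{i,K}-\Delta_K^{p-1}c^{p-1}_{i,K}\big)+J^{p,\star}_{i,K+\frac12}-J^{p,\star}_{i,K-\frac12}=0,$$ with $\boldsymbol J^{p,\star}_{\frac12}=\boldsymbol J^{p,\star}_{N+\frac12}=0$; $\Delta x\,\boldsymbol J^{p,\star}_{K+\frac12}=-\widehat{\boldsymbol A}_s(\boldsymbol c^{p,\star}_{K+\frac12})D_{K+\frac12}\boldsymbol c^{p,\star}$ for $1\le K<K^{p-1}$; the Stefan–Maxwell linear system $\Delta x\,\check{\widetilde{\boldsymbol A}}_g(\boldsymbol c^{p,\star}_{K+\frac12})\boldsymbol J^{p,\star}_{K+\frac12}=-D_{K+\frac12}\boldsymbol c^{p,\star}$ for $K^{p-1}<K\le N-1$; $\boldsymbol J^{p,\star}_{K^{p-1}+\frac12}=-\boldsymbol F^{p,\star}$, where $F^{p,\star}_i=\sqrt{\beta_i^*}\,c^{p,\star}_{i,K^{p-1}+1}-\frac1{\sqrt{\beta_i^*}}c^{p,\star}_{i,K^{p-1}}$; and $X^p=X^{p-1}+\Delta t\sum_{i=1}^nF_i^{p,\star}$. Post-processing (defining $\boldsymbol c^p$ when $1<K^p<N$). If $K^p=K^{p-1}$: $\boldsymbol c^p=\boldsymbol c^{p,\star}$. If $K^p=K^{p-1}+1<N$: $c^p_{i,K^{p-1}}=c^p_{i,K^{p-1}+1}=c^{p,\star}_{i,K^{p-1}}$, $c^p_{i,K^p+1}=\frac{\Delta^{p,\star}_{K^p}c^{p,\star}_{i,K^p}+\Delta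 x\,c^{p,\star}_{i,K^p+1}}{\Delta x+\Delta^{p,\star}_{K^p}}$, and $c^p_{i,K}=c^{p,\star}_{i,K}$ for the other $K$. If $K^p=K^{p-1}-1>1$, symmetrically: $c^p_{i,K^{p-1}}=c^p_{i,K^{p-1}+1}=c^{p,\star}_{i,K^{p-1}+1}$, $c^p_{i,K^{p-1}-1}=\frac{\Delta x\,c^{p,\star}_{i,K^{p-1}-1}+\Delta^{p,\star}_{K^{p-1}}c^{p,\star}_{i,K^{p-1}}}{\Delta x+\Delta^{p,\star}_{K^{p-1}}}$, and $c^p_{i,K}=c^{p,\star}_{i,K}$ for the other $K$. (If $K^p\in\{1,N\}$ the simulation switches to a single phase.) Discrete free energy. For $\alpha\in\{s,g\}$, $h_\alpha(\boldsymbol c)=\sum_{i=1}^n\big(c_i(\log c_i+\mu_i^{*,\alpha})-c_i+1\big)$ with $0\log0=0$; $\alpha_K^q=s$ if $K\le K^q$ and $\alpha_K^q=g$ if $K>K^q$; $\mathcal H^q(\boldsymbol c^q,X^q)=\sum_{K=1}^N\Delta_K^qh_{\alpha_K^q}(\boldsymbol c_K^q)$. *)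

theory Defs
  imports "HOL-Analysis.Analysis"
begin

text \<open>Species are indexed by a finite type (so the number of species is \<open>CARD('n)\<close>).
  A family of cell vectors is a function \<open>c :: nat \<Rightarrow> real^'n\<close> of which only the values at
  \<open>1, \<dots>, N\<close> matter.  Half-integer indices are shifted down: \<open>xedge N K\<close>, \<open>J K\<close>,
  \<open>edge_conc c K\<close> and \<open>jump c K\<close> are the quantities with index \<open>K + 1/2\<close>.\<close>

datatype phase = Solid | Gas

subsection \<open>Mobilities\<close>

definition kappa_min :: "('n::finite \<Rightarrow> 'n \<Rightarrow> real) \<Rightarrow> real" where
  "kappa_min \<kappa> = Min {\<kappa> i j | i j. i \<noteq> j}"

definition A_bar :: "('n::finite \<Rightarrow> 'n \<Rightarrow> real) \<Rightarrow> real^'n \<Rightarrow> real^'n^'n" where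
  "A_bar \<kappa> u = (\<chi> i j. if i = j then (\<Sum>k\<in>UNIV - {i}. (\<kappa> i k - kappa_min \<kappa>) * u $ k)
                       else - (\<kappa> i j - kappa_min \<kappa>) * u $ i)"

definition A_shift :: "('n::finite \<Rightarrow> 'n \<Rightarrow> real) \<Rightarrow> real^'n \<Rightarrow> real^'n^'n" where
  "A_shift \<kappa> u = A_bar \<kappa> u + mat (kappa_min \<kappa>)"

text \<open>\<open>A_shift (\<kappa> Gas)\<close> is the Stefan--Maxwell matrix.  In the gas phase \<open>A_hat\<close> is
  meaningful only where that matrix is invertible.\<close>

definition A_hat :: "(phase \<Rightarrow> 'n::finite \<Rightarrow> 'n \<Rightarrow> real) \<Rightarrow> phase \<Rightarrow> real^'n \<Rightarrow> real^'n^'n" where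
  "A_hat \<kappa> \<alpha> u = (case \<alpha> of Solid \<Rightarrow> A_shift (\<kappa> Solid) u
                           | Gas \<Rightarrow> matrix_inv (A_shift (\<kappa> Gas) u))"

definition M_hat :: "(phase \<Rightarrow> 'n::finite \<Rightarrow> 'n \<Rightarrow> real) \<Rightarrow> phase \<Rightarrow> real^'n \<Rightarrow> real^'n^'n" where
  "M_hat \<kappa> \<alpha> u = A_hat \<kappa> \<alpha> u ** (\<chi> i j. if i = j then u $ i else 0)"

definition beta :: "(phase \<Rightarrow> real^'n::finite) \<Rightarrow> 'n \<Rightarrow> real" where
  "beta \<mu> i = exp (\<mu> Gas $ i - \<mu> Solid $ i)"

definition speed_bound :: "(phase \<Rightarrow> real^'n::finite) \<Rightarrow> real" where
  "speed_bound \<mu> = Max (range (\<lambda>i. 2 * cosh (1/2 * (\<mu> Gas $ i - \<mu> Solid $ i))))"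

subsection \<open>Mesh\<close>

definition dx :: "nat \<Rightarrow> real" where
  "dx N = 1 / real N"

definition xedge :: "nat \<Rightarrow> nat \<Rightarrow> real" where
  "xedge N K = real K * dx N"

definition iface :: "nat \<Rightarrow> real \<Rightarrow> nat" where
  "iface N X = (LEAST K. is_arg_min (\<lambda>L. \<bar>xedge N L - X\<bar>) (\<lambda>L. L \<le> N) K)"

text \<open>The size of cell \<open>K \<ge> 1\<close> when the edge with index \<open>m + 1/2\<close> is moved to \<open>X\<close>.
  The sizes at time \<open>q\<close> are obtained for \<open>m = iface N X\<^sup>q\<close> and \<open>X = X\<^sup>q\<close>; the
  intermediate sizes for \<open>m\<close> the old interface index and \<open>X\<close> the new position.\<close>

definition cell_size :: "nat \<Rightarrow> nat \<Rightarrow> real \<Rightarrow> nat \<Rightarrow> real" where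
  "cell_size N m X K = (if K = m then X - xedge N (m - 1)
                        else if K = m + 1 then xedge N (m + 1) - X
                        else dx N)"

definition cell_size_at :: "nat \<Rightarrow> real \<Rightarrow> nat \<Rightarrow> real" where
  "cell_size_at N X = cell_size N (iface N X) X"

definition cell_phase :: "nat \<Rightarrow> real \<Rightarrow> nat \<Rightarrow> phase" where
  "cell_phase N X K = (if K \<le> iface N X then Solid else Gas)"

subsection \<open>Discrete operators\<close>

definition jump :: "(nat \<Rightarrow> real^'n) \<Rightarrow> nat \<Rightarrow> real^'n" where
  "jump d K = d (K + 1) - d K"

definition vlog :: "real^'n \<Rightarrow> real^'n" where
  "vlog v = (\<chi> i. ln (v $ i))"

definition log_mean :: "real \<Rightarrow> real \<Rightarrow> real" where
  "log_mean a b = (if min a b \<le> 0 then 0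
                   else if a = b then a
                   else (a - b) / (ln a - ln b))"

definition edge_conc :: "(nat \<Rightarrow> real^'n) \<Rightarrow> nat \<Rightarrow> real^'n" where
  "edge_conc c K = (\<chi> i. log_mean (c K $ i) (c (K + 1) $ i))"

definition diamond :: "real^'n::finite \<Rightarrow> real^'n" where
  "diamond x = (\<chi> i. max (x $ i) 0 / max 1 (\<Sum>j\<in>UNIV. max (x $ j) 0))"

subsection \<open>The scheme\<close>

definition iface_flux ::
    "(phase \<Rightarrow> real^'n::finite) \<Rightarrow> nat \<Rightarrow> (nat \<Rightarrow> real^'n) \<Rightarrow> real^'n" where
  "iface_flux \<mu> m c = (\<chi> i. sqrt (beta \<mu> i) * c (m + 1) $ i - 1 / sqrt (beta \<mu> i) * c m $ i)"

text \<open>\<open>(c0, X0)\<close> is the given state, \<open>(c, X, J)\<close> the unknown.\<close>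

definition scheme_solution ::
    "(phase \<Rightarrow> 'n::finite \<Rightarrow> 'n \<Rightarrow> real) \<Rightarrow> (phase \<Rightarrow> real^'n) \<Rightarrow> nat \<Rightarrow> real
      \<Rightarrow> (nat \<Rightarrow> real^'n) \<Rightarrow> real \<Rightarrow> (nat \<Rightarrow> real^'n) \<Rightarrow> real \<Rightarrow> (nat \<Rightarrow> real^'n) \<Rightarrow> bool" where
  "scheme_solution \<kappa> \<mu> N dt c0 X0 c X J \<longleftrightarrow>
     (let m = iface N X0; F = iface_flux \<mu> m c in
       X \<in> {0..1} \<and>
       (\<forall>i. \<forall>K\<in>{1..N}.
          1 / dt * (cell_size N m X K * c K $ i - cell_size_at N X0 K * c0 K $ i)
            + J K $ i - J (K - 1) $ i = 0) \<and>
       J 0 = 0 \<and> J N = 0 \<and>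
       (\<forall>K. 1 \<le> K \<and> K < m \<longrightarrow>
          dx N *\<^sub>R J K = - (A_hat \<kappa> Solid (edge_conc c K) *v jump c K)) \<and>
       (\<forall>K. m < K \<and> K \<le> N - 1 \<longrightarrow>
          dx N *\<^sub>R (A_shift (\<kappa> Gas) (edge_conc c K) *v J K) = - jump c K) \<and>
       J m = - F \<and>
       X = X0 + dt * (\<Sum>i\<in>UNIV. F $ i))"

text \<open>Here \<open>c'\<close> is the post-processed family obtained from the intermediate family \<open>c\<close>,
  with interface positions \<open>X0\<close> (old) and \<open>X\<close> (new).  It is used only for
  \<open>1 < iface N X < N\<close>; no \<open>c'\<close> is related to \<open>c\<close> if the interface index changes by
  more than one.\<close>

definition post_processed ::
    "nat \<Rightarrow> real \<Rightarrow> real \<Rightarrow> (nat \<Rightarrow> real^'n) \<Rightarrow> (nat \<Rightarrow> real^'n) \<Rightarrow> bool" where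
  "post_processed N X0 X c c' \<longleftrightarrow>
     (let m = iface N X0; m' = iface N X; \<Delta> = cell_size N m X in
       m' = m \<and> (\<forall>K\<in>{1..N}. c' K = c K)
     \<or> m' = m + 1 \<and> m' < N \<and>
         c' m = c m \<and> c' (m + 1) = c m \<and>
         c' (m' + 1) = (1 / (dx N + \<Delta> m')) *\<^sub>R (\<Delta> m' *\<^sub>R c m' + dx N *\<^sub>R c (m' + 1)) \<and>
         (\<forall>K\<in>{1..N} - {m, m + 1, m' + 1}. c' K = c K)
     \<or> m = m' + 1 \<and> 1 < m' \<and>
         c' m = c (m + 1) \<and> c' (m + 1) = c (m + 1) \<and>
         c' (m - 1) = (1 / (dx N + \<Delta> m)) *\<^sub>R (dx N *\<^sub>R c (m - 1) + \<Delta> m *\<^sub>R c m) \<and>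
         (\<forall>K\<in>{1..N} - {m - 1, m, m + 1}. c' K = c K))"

subsection \<open>Free energy\<close>

text \<open>The convention \<open>0 log 0 = 0\<close> is automatic, as \<open>ln\<close> is total.\<close>

definition energy_density :: "(phase \<Rightarrow> real^'n::finite) \<Rightarrow> phase \<Rightarrow> real^'n \<Rightarrow> real" where
  "energy_density \<mu> \<alpha> c = (\<Sum>i\<in>UNIV. c $ i * (ln (c $ i) + \<mu> \<alpha> $ i) - c $ i + 1)"

definition free_energy ::
    "(phase \<Rightarrow> real^'n::finite) \<Rightarrow> nat \<Rightarrow> (nat \<Rightarrow> real^'n) \<Rightarrow> real \<Rightarrow> real" where
  "free_energy \<mu> N c X =
     (\<Sum>K=1..N. cell_size_at N X K * energy_density \<mu> (cell_phase N X K) (c K))"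

end

theory Submission
  imports Defs
begin

text \<open>Why the theorem holds.  The key observation is that every family of nonnegative cell
  vectors with unit cell totals is an admissible guess.  Given such a family \<open>c\<close>, let the
  interface move by the law of the scheme, compute the fluxes (inverting the Stefan--Maxwell
  matrix, which is strictly diagonally dominant by columns), and call defect of \<open>c\<close> the amount
  by which the balance equation fails in each cell.  Two structural facts hold for this defect.

  \<^item> It is tangent to the product of simplices: all columns of the mobility matrices have the
    same sum, so the fluxes between cells of the same phase have total zero, while the total flux
    across the interface is exactly what the change of the two adjacent cell sizes requires.
    The components of the defect therefore sum to zero in each cell.
  \<^item> It is quasi-positive: if a species is absent from a cell, the logarithmic mean kills the
    cross-diffusion terms at both edges of the cell, the remaining flux of this species can only
    enter the cell, and its defect component is nonpositive.

  A continuous field with these two properties on a product of simplices has a zero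
  (\<open>quasi_positive_field_has_zero\<close>).  This follows from Brouwer's theorem by the map that Nash used
  for equilibria: raise each coordinate by the negative part of the field and normalise.  The
  dimension (number of cells times number of species) varies with \<open>N\<close>, so Brouwer's
  theorem is derived from Kuhn's combinatorial lemma for cubes of arbitrary finite dimension
  (\<open>brouwer_coordinate_cube\<close>).

  A zero of the defect solves the scheme, with unit totals in all cells.  It is positive because
  a vanishing component would spread from cell to neighbouring cell, across the interface too,
  and contradict the conserved positive mass of the species (\<open>positive\<close>).

  The energy inequality (\<open>energy_inequality_before_remeshing\<close>) is the convexity of \<open>x ln x\<close>
  tested against the chemical potentials, followed by summation by parts.  Two points are
  specific to the moving mesh.  The change of a cell size multiplies
  \<open>h(c) - \<nabla>h(c) \<bullet> c\<close>, which is the same constant for all vectors of total one, in both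
  phases, and the size changes cancel.  The logarithmic mean turns jumps of concentrations into jumps of
  logarithms exactly, which produces the quadratic form of the mobility.  Finally, the interface
  index changes by at most one, and passing to the new cells only merges or splits cells of the
  same phase, so that mass is kept and Jensen's inequality lets the energy decrease
  (\<open>remeshing\<close>).\<close>

section \<open>Brouwer's theorem on coordinate cubes\<close>

lemma compact_coordinate_cube: "compact {x :: 'a \<Rightarrow> real. \<forall>a. x a \<in> {0..1}}"
proof -
  have "compactin (product_topology (\<lambda>_. euclidean) UNIV) (PiE UNIV (\<lambda>_::'a. {0..1::real}))"
    by (simp add: compactin_PiE)
  moreover have "PiE UNIV (\<lambda>_::'a. {0..1::real}) = {x. \<forall>a. x a \<in> {0..1}}"
    by (auto simp: PiE_def Pi_def)
  ultimately show ?thesis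
    by (simp add: euclidean_product_topology)
qed

lemma tendsto_fun_coordinatewise:
  fixes f :: "'b \<Rightarrow> 'a \<Rightarrow> 'c::topological_space"
  assumes "\<And>a. ((\<lambda>k. f k a) \<longlongrightarrow> l a) F"
  shows "(f \<longlongrightarrow> l) F"
  using assms limitin_componentwise[of "\<lambda>_. euclidean" UNIV f l F]
  by (simp add: euclidean_product_topology)

lemma tendsto_fun_coordinate:
  fixes f :: "'b \<Rightarrow> 'a \<Rightarrow> 'c::topological_space"
  assumes "(f \<longlongrightarrow> l) F"
  shows "((\<lambda>k. f k a) \<longlongrightarrow> l a) F"
  using assms limitin_componentwise[of "\<lambda>_. euclidean" UNIV f l F]
  by (simp add: euclidean_product_topology)

text \<open>Kuhn's lemma, applied on the grid of mesh \<open>1/p\<close>, yields for each coordinate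
  two nearby grid points at which this coordinate is not decreased and not increased by \<open>f\<close>,
  respectively.  All these points lie in one grid cell, so as \<open>p\<close> grows they have a common limit
  along a subsequence, and continuity forces both inequalities there.\<close>

theorem brouwer_coordinate_cube:
  fixes f :: "('a::countable \<Rightarrow> real) \<Rightarrow> 'a \<Rightarrow> real"
  defines "C \<equiv> {x :: 'a \<Rightarrow> real. \<forall>a. x a \<in> {0..1}}"
  assumes "finite I"
    and cont: "\<And>a. a \<in> I \<Longrightarrow> continuous_on C (\<lambda>x. f x a)"
    and into: "\<And>x a. x \<in> C \<Longrightarrow> a \<in> I \<Longrightarrow> f x a \<in> {0..1}"
  obtains x where "x \<in> C" "\<And>a. a \<in> I \<Longrightarrow> f x a = x a"
proof -
  define n where "n = card I"
  obtain e where e: "bij_betw e {..<n} I"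
    using ex_bij_betw_nat_finite[OF \<open>finite I\<close>] by (auto simp: n_def atLeast0LessThan)
  define d where "d = inv_into {..<n} e"
  have d: "d a < n" "e (d a) = a" if "a \<in> I" for a
    using e that bij_betw_inv_into[OF e] bij_betw_inv_into_right[OF e]
    by (auto simp: d_def bij_betw_def)
  have ei: "e i \<in> I" "d (e i) = i" if "i < n" for i
    using e that bij_betw_inv_into_left[OF e] by (auto simp: d_def bij_betw_def)
  define pt :: "nat \<Rightarrow> (nat \<Rightarrow> nat) \<Rightarrow> 'a \<Rightarrow> real"
    where "pt p q = (\<lambda>a. if a \<in> I then real (q (d a)) / real p else 0)" for p q
  have ptC: "pt p q \<in> C" if "\<forall>i<n. q i \<le> p" for p q
    using that d by (auto simp: pt_def C_def divide_le_eq_1)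
  have "\<exists>z\<in>C. \<forall>a\<in>I. \<exists>u\<in>C. \<exists>v\<in>C. (\<forall>b. \<bar>u b - z b\<bar> \<le> 1 / real (Suc k)) \<and>
      (\<forall>b. \<bar>v b - z b\<bar> \<le> 1 / real (Suc k)) \<and> u a \<le> f u a \<and> f v a \<le> v a" for k
  proof -
    define p where "p = Suc k"
    \<comment> \<open>A point on the upper face must get label 1; there \<open>f\<close> cannot increase the coordinate.\<close>
    define label :: "(nat \<Rightarrow> nat) \<Rightarrow> nat \<Rightarrow> nat"
      where "label q i = (if pt p q (e i) \<le> f (pt p q) (e i) \<and> q i \<noteq> p then 0 else 1)" for q i
    have lab0: "\<forall>q. (\<forall>i<n. q i \<le> p) \<longrightarrow> (\<forall>i<n. q i = 0 \<longrightarrow> label q i = 0)"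
    proof (intro allI impI)
      fix q i assume q: "\<forall>i<n. q i \<le> p" and i: "i < n" "q i = 0"
      have "f (pt p q) (e i) \<in> {0..1}"
        using into ptC q ei i by blast
      then show "label q i = 0"
        using i ei by (auto simp: label_def pt_def p_def)
    qed
    have lab: "\<forall>q. (\<forall>i<n. q i \<le> p) \<longrightarrow> (\<forall>i<n. label q i = 0 \<or> label q i = 1)"
      and labp: "\<forall>q. (\<forall>i<n. q i \<le> p) \<longrightarrow> (\<forall>i<n. q i = p \<longrightarrow> label q i = 1)" and p: "0 < p"
      by (auto simp: label_def p_def)
    obtain q where q: "\<forall>i<n. q i < p" and rs: "\<forall>i<n. \<exists>r s.
        (\<forall>j<n. q j \<le> r j \<and> r j \<le> q j + 1) \<and> (\<forall>j<n. q j \<le> s j \<and> s j \<le> q j + 1) \<and>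
        label r i \<noteq> label s i"
      by (rule kuhn_lemma[OF p lab lab0 labp])
    have near: "\<bar>pt p r b - pt p q b\<bar> \<le> 1 / real (Suc k)" "pt p r \<in> C"
      if "\<forall>j<n. q j \<le> r j \<and> r j \<le> q j + 1" for r b
    proof -
      show "pt p r \<in> C"
        using that q by (intro ptC) (metis Suc_eq_plus1 Suc_leI le_trans)
      show "\<bar>pt p r b - pt p q b\<bar> \<le> 1 / real (Suc k)"
      proof (cases "b \<in> I")
        case True
        then have "q (d b) \<le> r (d b)" "r (d b) \<le> q (d b) + 1"
          using that d by auto
        then have "\<bar>real (r (d b)) - real (q (d b))\<bar> \<le> 1" by linarith
        then show ?thesis
          using True by (simp add: pt_def p_def diff_divide_distrib[symmetric] divide_right_mono)
      qed (simp add: pt_def)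
    qed
    have "\<exists>u\<in>C. \<exists>v\<in>C. (\<forall>b. \<bar>u b - pt p q b\<bar> \<le> 1 / real (Suc k)) \<and>
      (\<forall>b. \<bar>v b - pt p q b\<bar> \<le> 1 / real (Suc k)) \<and> u a \<le> f u a \<and> f v a \<le> v a"
      if "a \<in> I" for a
    proof -
      have low: "pt p r a \<le> f (pt p r) a" if "label r (d a) = 0" for r
        using that d[OF \<open>a \<in> I\<close>] by (auto simp: label_def split: if_splits)
      have high: "f (pt p r) a \<le> pt p r a" if "label r (d a) \<noteq> 0" "pt p r \<in> C" for r
      proof (cases "r (d a) = p")
        case True
        then have "pt p r a = 1"
          using \<open>a \<in> I\<close> by (simp add: pt_def p_def)
        then show ?thesis
          using into[OF that(2) \<open>a \<in> I\<close>] by simp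
      next
        case False
        then show ?thesis
          using that d[OF \<open>a \<in> I\<close>] by (auto simp: label_def split: if_splits)
      qed
      have pair: ?thesis if "\<forall>j<n. q j \<le> r j \<and> r j \<le> q j + 1"
        "\<forall>j<n. q j \<le> s j \<and> s j \<le> q j + 1" "label r (d a) = 0" "label s (d a) \<noteq> 0" for r s
        using low[OF that(3)] high[OF that(4)] near[OF that(1)] near[OF that(2)]
        by (intro bexI[of _ "pt p r"] bexI[of _ "pt p s"] conjI allI) blast+
      obtain r s where rs: "\<forall>j<n. q j \<le> r j \<and> r j \<le> q j + 1"
        "\<forall>j<n. q j \<le> s j \<and> s j \<le> q j + 1" "label r (d a) \<noteq> label s (d a)"
        using rs d(1)[OF \<open>a \<in> I\<close>] by blast
      show ?thesis
      proof (cases "label r (d a) = 0")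
        case True
        then show ?thesis using pair[OF rs(1,2)] rs(3) by simp
      next
        case False
        then have "label s (d a) = 0"
          using rs(3) by (simp add: label_def split: if_splits)
        then show ?thesis using pair[OF rs(2,1)] False by simp
      qed
    qed
    then show ?thesis
      using ptC[of q p] q less_imp_le by blast
  qed
  then obtain z where z: "\<And>k. z k \<in> C" and "\<forall>k. \<forall>a\<in>I. \<exists>u\<in>C. \<exists>v\<in>C.
      (\<forall>b. \<bar>u b - z k b\<bar> \<le> 1 / real (Suc k)) \<and>
      (\<forall>b. \<bar>v b - z k b\<bar> \<le> 1 / real (Suc k)) \<and> u a \<le> f u a \<and> f v a \<le> v a"
    by metis
  then obtain u v where uv: "\<And>k a. a \<in> I \<Longrightarrow> u k a \<in> C \<and> v k a \<in> C \<and>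
      (\<forall>b. \<bar>u k a b - z k b\<bar> \<le> 1 / real (Suc k)) \<and>
      (\<forall>b. \<bar>v k a b - z k b\<bar> \<le> 1 / real (Suc k)) \<and>
      u k a a \<le> f (u k a) a \<and> f (v k a) a \<le> v k a a"
    by metis
  have "seq_compact C"
    using compact_coordinate_cube compact_eq_seq_compact_metric unfolding C_def by blast
  then obtain x r where x: "x \<in> C" and r: "strict_mono r" and lim: "(z \<circ> r) \<longlonglongrightarrow> x"
    using z unfolding seq_compact_def by metis
  have close: "(\<lambda>k. w (r k)) \<longlonglongrightarrow> x" if "\<And>k b. \<bar>w k b - z k b\<bar> \<le> 1 / real (Suc k)" for w
  proof (rule tendsto_fun_coordinatewise)
    fix b
    have "(\<lambda>k. w k b - z k b) \<longlonglongrightarrow> 0"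
      using that by (intro tendsto_0_le[OF LIMSEQ_inverse_real_of_nat, of _ 1])
        (auto simp: inverse_eq_divide)
    then have "(\<lambda>k. w (r k) b - z (r k) b) \<longlonglongrightarrow> 0"
      using LIMSEQ_subseq_LIMSEQ[OF _ r] by (fastforce simp: o_def)
    moreover have "(\<lambda>k. z (r k) b) \<longlonglongrightarrow> x b"
      using tendsto_fun_coordinate[OF lim] by (simp add: o_def)
    ultimately show "(\<lambda>k. w (r k) b) \<longlonglongrightarrow> x b"
      using tendsto_add by fastforce
  qed
  have "f x a = x a" if a: "a \<in> I" for a
  proof (rule antisym)
    have u: "(\<lambda>k. u (r k) a) \<longlonglongrightarrow> x" and v: "(\<lambda>k. v (r k) a) \<longlonglongrightarrow> x"
      using uv[OF a] by (intro close[of "\<lambda>k. u k a"] close[of "\<lambda>k. v k a"]; simp)+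
    have fu: "(\<lambda>k. f (u (r k) a) a) \<longlonglongrightarrow> f x a" and fv: "(\<lambda>k. f (v (r k) a) a) \<longlonglongrightarrow> f x a"
      using continuous_on_tendsto_compose[OF cont[OF a] u x]
        continuous_on_tendsto_compose[OF cont[OF a] v x] uv[OF a] by auto
    show "f x a \<le> x a"
      using fv tendsto_fun_coordinate[OF v, of a] uv[OF a] by (intro LIMSEQ_le) auto
    show "x a \<le> f x a"
      using fu tendsto_fun_coordinate[OF u, of a] uv[OF a] by (intro LIMSEQ_le) auto
  qed
  then show thesis
    using that x by blast
qed

section \<open>Zeros of quasi-positive fields on products of simplices\<close>

text \<open>At a fixed point of the Nash map \<open>c \<mapsto> (c + G\<^sup>-) / (1 + \<Sum>G\<^sup>-)\<close>, one has
  \<open>c\<^sub>i t = G\<^sub>i\<^sup>-\<close> with \<open>t = \<Sum>G\<^sup>-\<close>.  If \<open>t > 0\<close>, then \<open>G\<close> is negative where \<open>c\<close> is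
  positive and, by quasi-positivity, nonpositive elsewhere.  This contradicts the zero sum, so
  \<open>G\<close> has no negative component, and again by the zero sum it vanishes.\<close>

lemma quasi_positive_field_has_zero:
  fixes G :: "(nat \<Rightarrow> real^'n) \<Rightarrow> nat \<Rightarrow> real^'n"
  defines "S \<equiv> {c. \<forall>K. (\<forall>i. 0 \<le> c K $ i) \<and> (\<Sum>i\<in>UNIV. c K $ i) = 1}"
  assumes "finite A"
    and cont: "\<And>K i. K \<in> A \<Longrightarrow> continuous_on S (\<lambda>c. G c K $ i)"
    and tangent: "\<And>c K. c \<in> S \<Longrightarrow> K \<in> A \<Longrightarrow> (\<Sum>i\<in>UNIV. G c K $ i) = 0"
    and quasi_pos: "\<And>c K i. c \<in> S \<Longrightarrow> K \<in> A \<Longrightarrow> c K $ i = 0 \<Longrightarrow> G c K $ i \<le> 0"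
  obtains c where "c \<in> S" "\<And>K. K \<in> A \<Longrightarrow> G c K = 0"
proof -
  define C where "C = {x :: nat \<times> 'n \<Rightarrow> real. \<forall>a. x a \<in> {0..1}}"
  define s where "s x K = (\<Sum>i\<in>UNIV. x (K, i))" for x :: "nat \<times> 'n \<Rightarrow> real" and K
  \<comment> \<open>A continuous retraction of the cube onto the product of simplices: fill a deficit of the
    total evenly, and divide out an excess.\<close>
  define ret :: "(nat \<times> 'n \<Rightarrow> real) \<Rightarrow> nat \<Rightarrow> real^'n"
    where "ret x K = (\<chi> i. (x (K, i) + max 0 (1 - s x K) / CARD('n)) / max 1 (s x K))" for x K
  define neg where "neg c K i = max 0 (- G c K $ i)" for c K i
  define f where "f x a = (ret x (fst a) $ snd a + neg (ret x) (fst a) (snd a))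
      / (1 + (\<Sum>j\<in>UNIV. neg (ret x) (fst a) j))" for x a
  have neg_nonneg: "0 \<le> neg c K i" for c K i
    by (simp add: neg_def)
  have denom_pos: "0 < 1 + (\<Sum>j\<in>UNIV. neg c K j)" for c K
    using sum_nonneg[of UNIV "neg c K"] neg_nonneg by (simp add: add_pos_nonneg)
  have ret_S: "ret x \<in> S" if "x \<in> C" for x
  proof -
    have "(\<Sum>i\<in>UNIV. ret x K $ i) = 1" for K
    proof -
      have "(\<Sum>i\<in>UNIV. ret x K $ i) = (s x K + max 0 (1 - s x K)) / max 1 (s x K)"
        by (simp add: ret_def sum_divide_distrib[symmetric] sum.distrib s_def)
      also have "\<dots> = 1" by (auto simp: max_def)
      finally show ?thesis .
    qed
    moreover have "0 \<le> ret x K $ i" for K i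
      using that by (auto simp: ret_def C_def)
    ultimately show ?thesis by (auto simp: S_def)
  qed
  have ret_comp: "continuous_on C (\<lambda>x. ret x K $ i)" for K i
    unfolding ret_def s_def
    by (simp, intro continuous_intros continuous_on_max continuous_on_subset[OF continuous_on_product_coordinates]) auto
  then have ret_cont: "continuous_on C ret"
    by (intro continuous_on_coordinatewise_then_product) (subst vec_lambda_eta[symmetric], intro continuous_on_vec_lambda)
  have G_comp: "continuous_on C (\<lambda>x. G (ret x) K $ i)" if "K \<in> A" for K i
    using continuous_on_compose2[OF cont[OF that] ret_cont] ret_S by blast
  obtain x where x: "x \<in> C" and fixed: "\<And>a. a \<in> A \<times> UNIV \<Longrightarrow> f x a = x a"
  proof (rule brouwer_coordinate_cube[of "A \<times> (UNIV :: 'n set)" f])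
    show "finite (A \<times> (UNIV :: 'n set))"
      using \<open>finite A\<close> by simp
    fix a assume a: "a \<in> A \<times> (UNIV :: 'n set)"
    have "continuous_on C (\<lambda>x. f x a)"
      unfolding f_def neg_def using denom_pos[unfolded neg_def] a
      by (intro continuous_intros continuous_on_max ret_comp G_comp) (auto simp: less_imp_neq[symmetric])
    then show "continuous_on {x. \<forall>a. x a \<in> {0..1}} (\<lambda>x. f x a)"
      by (simp add: C_def)
    fix x :: "nat \<times> 'n \<Rightarrow> real" assume "x \<in> {x. \<forall>a. x a \<in> {0..1}}"
    then have r: "ret x \<in> S" using ret_S C_def by blast
    obtain K i where "a = (K, i)" by (cases a)
    have "0 \<le> ret x K $ i" "ret x K $ i \<le> 1"
      using r member_le_sum[of i UNIV "\<lambda>i. ret x K $ i"] by (auto simp: S_def)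
    moreover have "neg (ret x) K i \<le> (\<Sum>j\<in>UNIV. neg (ret x) K j)"
      using neg_nonneg by (intro member_le_sum) auto
    ultimately show "f x a \<in> {0..1}"
      using denom_pos[of "ret x" K] neg_nonneg[of "ret x" K i]
      by (auto simp: f_def \<open>a = (K, i)\<close> divide_le_eq_1)
  qed (auto simp: C_def)
  define c where "c = ret x"
  have c: "c \<in> S" using ret_S x c_def by blast
  have "G c K = 0" if K: "K \<in> A" for K
  proof -
    define t where "t = (\<Sum>j\<in>UNIV. neg c K j)"
    have t: "0 < 1 + t" using denom_pos by (simp add: t_def)
    have xf: "x (K, i) = (c K $ i + neg c K i) / (1 + t)" for i
      using fixed[of "(K, i)"] K by (simp add: f_def c_def t_def)
    have "s x K = ((\<Sum>i\<in>UNIV. c K $ i) + t) / (1 + t)"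
      unfolding s_def xf by (simp add: sum_divide_distrib[symmetric] sum.distrib t_def)
    then have "s x K = 1"
      using c t by (simp add: S_def)
    then have "c K $ i = x (K, i)" for i
      by (simp add: c_def ret_def)
    then have fixpt: "c K $ i * t = neg c K i" for i
      using xf[of i] t by (simp add: field_simps)
    have "t = 0"
    proof (rule ccontr)
      assume "t \<noteq> 0"
      then have "0 < t"
        using sum_nonneg[of UNIV "neg c K"] neg_nonneg t_def by fastforce
      \<comment> \<open>Positive coordinates satisfy this by the fixed-point equation, zero coordinates by
        quasi-positivity.\<close>
      have le: "G c K $ i \<le> 0" for i
      proof (cases "c K $ i = 0")
        case False
        then have "0 < c K $ i"
          using c by (auto simp: S_def less_le)
        then have "0 < neg c K i"
          using \<open>0 < t\<close> fixpt[of i] mult_pos_pos by metis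
        then show ?thesis by (simp add: neg_def)
      qed (use quasi_pos c K in blast)
      then have "G c K $ i = 0" for i
        using tangent[OF c K] sum_nonneg_eq_0_iff[of UNIV "\<lambda>i. - G c K $ i"] by (simp add: sum_negf)
      then show False
        using \<open>0 < t\<close> by (simp add: t_def neg_def)
    qed
    then have "neg c K i = 0" for i
      using fixpt[of i] by simp
    then have "0 \<le> G c K $ i" for i
      by (metis neg_def max.cobounded2 neg_le_0_iff_le)
    then have "G c K $ i = 0" for i
      using tangent[OF c K] sum_nonneg_eq_0_iff[of UNIV "\<lambda>i. G c K $ i"] by simp
    then show ?thesis
      by (simp add: vec_eq_iff)
  qed
  then show thesis
    using that c by blast
qed

section \<open>The logarithmic mean\<close>

lemma log_mean_commute: "log_mean a b = log_mean b a"
proof -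
  have "(a - b) / (ln a - ln b) = (b - a) / (ln b - ln a)"
    by (metis minus_diff_eq minus_divide_divide)
  then show ?thesis by (auto simp: log_mean_def min.commute)
qed

lemma log_mean_times_ln_diff:
  assumes "0 < a" "0 < b"
  shows "log_mean a b * (ln a - ln b) = a - b"
  using assms by (auto simp: log_mean_def)

text \<open>By \<open>ln x \<le> x - 1\<close> at \<open>b / a\<close> and at \<open>a / b\<close>.\<close>

lemma log_mean_between:
  assumes "0 \<le> a" "0 \<le> b"
  shows "min a b \<le> log_mean a b \<and> log_mean a b \<le> max a b"
proof -
  have less: "a \<le> log_mean a b \<and> log_mean a b \<le> b" if "0 < a" "a < b" for a b :: real
  proof -
    have "ln (b / a) \<le> b / a - 1" "ln (a / b) \<le> a / b - 1"
      using that by (intro ln_le_minus_one; simp)+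
    then have "a * (ln b - ln a) \<le> b - a" "b - a \<le> b * (ln b - ln a)"
      using that by (simp_all add: ln_div field_simps)
    moreover have "0 < ln b - ln a"
      using that by simp
    moreover have "log_mean a b = (b - a) / (ln b - ln a)"
      using that by (subst log_mean_commute) (auto simp: log_mean_def)
    ultimately show ?thesis
      by (simp add: pos_le_divide_eq pos_divide_le_eq)
  qed
  consider "a = 0 \<or> b = 0" | "a = b" | "0 < a" "a < b" | "0 < b" "b < a"
    using assms by linarith
  then show ?thesis
  proof cases
    case 1
    then show ?thesis using assms by (auto simp: log_mean_def)
  next
    case 2
    then show ?thesis using assms by (auto simp: log_mean_def)
  next
    case 3
    then show ?thesis using less[OF 3] by auto
  next
    case 4
    then show ?thesis using less[OF 4] by (auto simp: log_mean_commute)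
  qed
qed

lemma log_mean_nonneg: "0 \<le> a \<Longrightarrow> 0 \<le> b \<Longrightarrow> 0 \<le> log_mean a b"
  using log_mean_between[of a b] by (auto simp: min_def split: if_splits)

lemma log_mean_pos: "0 < a \<Longrightarrow> 0 < b \<Longrightarrow> 0 < log_mean a b"
  using log_mean_between[of a b] by (auto simp: min_def split: if_splits)

text \<open>At the boundary the logarithmic mean decays only like \<open>1 / \<bar>ln a\<bar>\<close>, so it is not Lipschitz
  there; the radius is chosen such that \<open>ln b - ln a\<close> exceeds \<open>2 b0 / e\<close> while
  \<open>b - a\<close> is at most \<open>2 b0\<close>.\<close>

lemma log_mean_small:
  fixes b0 e :: real
  assumes "0 < b0" "0 < e"
  obtains d where "0 < d"
    "\<And>a b. 0 \<le> a \<Longrightarrow> a < d \<Longrightarrow> \<bar>b - b0\<bar> < d \<Longrightarrow> 0 \<le> log_mean a b \<and> log_mean a b < e"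
proof -
  define d where "d = b0 / 2 * exp (- (2 * b0) / e)"
  have exp_le: "exp (- (2 * b0) / e) \<le> 1"
    using assms by simp
  have d: "0 < d" "d \<le> b0 / 2"
    using assms mult_left_mono[OF exp_le, of "b0 / 2"] by (simp_all add: d_def)
  have "0 \<le> log_mean a b \<and> log_mean a b < e" if a: "0 \<le> a" "a < d" and b: "\<bar>b - b0\<bar> < d" for a b
  proof (cases "a = 0")
    case True
    then show ?thesis using assms by (simp add: log_mean_def)
  next
    case False
    then have "0 < a" using a by simp
    have b': "b0 / 2 < b" "b < 2 * b0" "a < b" "0 < b"
      using a b d assms by (simp_all add: abs_less_iff)
    have "ln d = ln (b0 / 2) - 2 * b0 / e"
      using assms unfolding d_def by (subst ln_mult_pos) simp_all
    moreover have "ln a < ln d" "ln (b0 / 2) < ln b"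
      using a b' \<open>0 < a\<close> d(1) assms by simp_all
    ultimately have "2 * b0 / e < ln b - ln a"
      by linarith
    moreover have "log_mean a b * (ln b - ln a) = b - a"
      using log_mean_times_ln_diff[of a b] \<open>0 < a\<close> b' by (simp add: algebra_simps)
    moreover have "0 < log_mean a b"
      using \<open>0 < a\<close> b' by (intro log_mean_pos)
    ultimately have "log_mean a b * (2 * b0 / e) < b - a"
      by (metis mult_strict_left_mono)
    also have "b - a < 2 * b0"
      using b' \<open>0 < a\<close> by linarith
    finally have "log_mean a b < e"
      using assms by (simp add: field_simps)
    then show ?thesis using \<open>0 < log_mean a b\<close> by simp
  qed
  then show thesis using that d(1) by blast
qed

text \<open>On the diagonal, the corner included, the logarithmic mean is squeezed between minimum
  and maximum; on the axes it is small by the preceding estimate; elsewhere its defining quotient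
  is continuous.\<close>

lemma continuous_on_log_mean:
  "continuous_on ({0..} \<times> {0..}) (\<lambda>p. log_mean (fst p) (snd p))" (is "continuous_on ?Q ?L")
proof -
  have axis: "(?L \<longlongrightarrow> 0) (at p within ?Q)"
    if "0 < b" and p: "p = (0, b) \<or> p = (b, 0)" for b p
  proof (rule tendstoI)
    fix e :: real assume "0 < e"
    obtain d where d: "0 < d"
      "\<And>x y. 0 \<le> x \<Longrightarrow> x < d \<Longrightarrow> \<bar>y - b\<bar> < d \<Longrightarrow> 0 \<le> log_mean x y \<and> log_mean x y < e"
      using log_mean_small[OF \<open>0 < b\<close> \<open>0 < e\<close>] by blast
    have "dist (?L q) 0 < e" if q: "q \<in> ?Q" "dist q p < d" for q
    proof -
      have "dist (fst q) (fst p) < d" "dist (snd q) (snd p) < d"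
        using q(2) dist_fst_le[of q p] dist_snd_le[of q p] by linarith+
      then have "0 \<le> ?L q \<and> ?L q < e"
        using p q(1) d(2)[of "fst q" "snd q"] d(2)[of "snd q" "fst q"]
        by (auto simp: dist_real_def log_mean_commute)
      then show ?thesis by simp
    qed
    then show "\<forall>\<^sub>F q in at p within ?Q. dist (?L q) 0 < e"
      using \<open>0 < d\<close> unfolding eventually_at by blast
  qed
  show ?thesis
    unfolding continuous_on_def
  proof
    fix p :: "real \<times> real" assume "p \<in> ?Q"
    then obtain a b where p: "p = (a, b)" and ab: "0 \<le> a" "0 \<le> b" by auto
    have in_Q: "\<forall>\<^sub>F q in at p within ?Q. q \<in> ?Q"
      by (simp add: eventually_at_filter)
    consider "a = b" | "a = 0" "0 < b" | "b = 0" "0 < a" | "0 < a" "0 < b" "a \<noteq> b"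
      using ab by linarith
    then show "(?L \<longlongrightarrow> ?L p) (at p within ?Q)"
    proof cases
      case 1
      then have "?L p = a" using ab p by (simp add: log_mean_def)
      have "((\<lambda>q. min (fst q) (snd q)) \<longlongrightarrow> min (fst p) (snd p)) (at p within ?Q)"
        "((\<lambda>q. max (fst q) (snd q)) \<longlongrightarrow> max (fst p) (snd p)) (at p within ?Q)"
        by (intro tendsto_intros)+
      then have "((\<lambda>q. min (fst q) (snd q)) \<longlongrightarrow> a) (at p within ?Q)"
        "((\<lambda>q. max (fst q) (snd q)) \<longlongrightarrow> a) (at p within ?Q)"
        using 1 p by simp_all
      then show ?thesis
        unfolding \<open>?L p = a\<close>
        by (rule tendsto_sandwich[rotated 2]; intro eventually_mono[OF in_Q])
          (use log_mean_between in auto)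
    next
      case 2
      then show ?thesis using axis[of b p] p by (simp add: log_mean_def)
    next
      case 3
      then show ?thesis using axis[of a p] p by (simp add: log_mean_def)
    next
      case 4
      have "\<forall>\<^sub>F q in nhds p. 0 < fst q \<and> 0 < snd q \<and> fst q \<noteq> snd q"
      proof -
        have "open {q :: real \<times> real. 0 < fst q \<and> 0 < snd q \<and> fst q \<noteq> snd q}"
          by (intro open_Collect_conj open_Collect_less open_Collect_neq continuous_intros)
        then show ?thesis
          using 4 p by (auto simp: eventually_nhds)
      qed
      then have ev: "\<forall>\<^sub>F q in at p within ?Q. (fst q - snd q) / (ln (fst q) - ln (snd q)) = ?L q"
        by (auto simp: eventually_at_filter log_mean_def elim: eventually_mono)
      have "((\<lambda>q. (fst q - snd q) / (ln (fst q) - ln (snd q))) \<longlongrightarrow>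
          (fst p - snd p) / (ln (fst p) - ln (snd p))) (at p within ?Q)"
        using 4 p by (intro tendsto_intros) auto
      moreover have "(fst p - snd p) / (ln (fst p) - ln (snd p)) = ?L p"
        using 4 p by (simp add: log_mean_def)
      ultimately show ?thesis
        using tendsto_cong[OF ev] by simp
    qed
  qed
qed

section \<open>Mobility matrices\<close>

lemma matrix_inv_mult_right:
  fixes A :: "real^'n^'n"
  assumes "invertible A"
  shows "A ** matrix_inv A = mat 1"
  using someI_ex[OF assms[unfolded invertible_def]] by (simp add: matrix_inv_def)

lemma continuous_on_matrix_mult:
  fixes A :: "'a::topological_space \<Rightarrow> real^'n^'n"
  assumes "\<And>i j. continuous_on S (\<lambda>x. A x $ i $ j)" "\<And>i. continuous_on S (\<lambda>x. b x $ i)"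
  shows "continuous_on S (\<lambda>x. (A x *v b x) $ k)"
  by (simp add: matrix_vector_mult_def, intro continuous_on_sum continuous_on_mult assms)

lemma continuous_on_det:
  fixes A :: "'a::topological_space \<Rightarrow> real^'n^'n"
  assumes "\<And>i j. continuous_on S (\<lambda>x. A x $ i $ j)"
  shows "continuous_on S (\<lambda>x. det (A x))"
  unfolding det_def
  by (intro continuous_on_sum continuous_on_mult continuous_on_const continuous_on_prod assms)

text \<open>Cramer's rule expresses the solution by determinants, hence by polynomials in the
  entries.\<close>

lemma continuous_on_matrix_inv_mult:
  fixes A :: "'a::topological_space \<Rightarrow> real^'n^'n"
  assumes "\<And>i j. continuous_on S (\<lambda>x. A x $ i $ j)" "\<And>i. continuous_on S (\<lambda>x. b x $ i)"
    and inv: "\<And>x. x \<in> S \<Longrightarrow> invertible (A x)"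
  shows "continuous_on S (\<lambda>x. (matrix_inv (A x) *v b x) $ k)"
proof -
  have det: "det (A x) \<noteq> 0" if "x \<in> S" for x
    using inv[OF that] by (simp add: invertible_det_nz)
  have "(matrix_inv (A x) *v b x) $ k = det (\<chi> i j. if j = k then b x $ i else A x $ i $ j) / det (A x)"
    if "x \<in> S" for x
  proof -
    have "A x *v (matrix_inv (A x) *v b x) = b x"
      using matrix_inv_mult_right[OF inv[OF that]] by (simp add: matrix_vector_mul_assoc)
    then show ?thesis
      using cramer[OF det[OF that], of "matrix_inv (A x) *v b x" "b x"] by simp
  qed
  moreover have "continuous_on S (\<lambda>x. if j = k then b x $ i else A x $ i $ j)" for i j
    using assms by (cases "j = k") auto
  then have "continuous_on S (\<lambda>x. det (\<chi> i j. if j = k then b x $ i else A x $ i $ j) / det (A x))"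
    using assms(1) det by (intro continuous_on_divide continuous_on_det) auto
  ultimately show ?thesis
    by (simp cong: continuous_on_cong)
qed

text \<open>Each product with the mobility matrix is a multiple of \<open>w\<close> plus a sum of exchange terms
  \<open>u\<^sub>k w\<^sub>i - u\<^sub>i w\<^sub>k\<close>, antisymmetric in the two species.  The diagonal index contributes
  zero to this sum, whatever the value of \<open>\<kappa> i i\<close>.\<close>

lemma A_shift_mult_vec:
  "(A_shift \<kappa> u *v w) $ i = kappa_min \<kappa> * w $ i
     + (\<Sum>k\<in>UNIV. (\<kappa> i k - kappa_min \<kappa>) * (u $ k * w $ i - u $ i * w $ k))"
proof -
  have "(A_bar \<kappa> u *v w) $ i = (\<Sum>j\<in>UNIV. A_bar \<kappa> u $ i $ j * w $ j)"
    by (simp add: matrix_vector_mult_def)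
  also have "\<dots> = A_bar \<kappa> u $ i $ i * w $ i + (\<Sum>j\<in>UNIV - {i}. A_bar \<kappa> u $ i $ j * w $ j)"
    by (simp add: sum.remove)
  also have "A_bar \<kappa> u $ i $ i * w $ i
      = (\<Sum>k\<in>UNIV - {i}. (\<kappa> i k - kappa_min \<kappa>) * (u $ k * w $ i))"
    by (simp add: A_bar_def sum_distrib_right mult.assoc)
  also have "(\<Sum>j\<in>UNIV - {i}. A_bar \<kappa> u $ i $ j * w $ j)
      = (\<Sum>k\<in>UNIV - {i}. - ((\<kappa> i k - kappa_min \<kappa>) * (u $ i * w $ k)))"
    by (intro sum.cong) (auto simp: A_bar_def algebra_simps)
  also have "(\<Sum>k\<in>UNIV - {i}. (\<kappa> i k - kappa_min \<kappa>) * (u $ k * w $ i)) + \<dots>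
      = (\<Sum>k\<in>UNIV - {i}. (\<kappa> i k - kappa_min \<kappa>) * (u $ k * w $ i - u $ i * w $ k))"
    by (simp add: sum.distrib[symmetric] right_diff_distrib)
  also have "\<dots> = (\<Sum>k\<in>UNIV. (\<kappa> i k - kappa_min \<kappa>) * (u $ k * w $ i - u $ i * w $ k))"
    by (simp add: sum.remove[of UNIV i])
  finally have "(A_bar \<kappa> u *v w) $ i
      = (\<Sum>k\<in>UNIV. (\<kappa> i k - kappa_min \<kappa>) * (u $ k * w $ i - u $ i * w $ k))" .
  moreover have "(mat (kappa_min \<kappa>) *v w) $ i = kappa_min \<kappa> * w $ i"
    by (simp add: matrix_vector_mult_def mat_def if_distrib[where f = "\<lambda>x. x * _"] cong: if_cong)
  ultimately show ?thesis
    by (simp add: A_shift_def matrix_vector_mult_add_rdistrib)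
qed

lemma continuous_on_A_shift:
  assumes "\<And>i. continuous_on S (\<lambda>x. u x $ i)"
  shows "continuous_on S (\<lambda>x. A_shift \<kappa> (u x) $ i $ j)"
  by (cases "i = j") (simp_all add: A_shift_def A_bar_def mat_def, (intro continuous_on_add
      continuous_on_sum continuous_on_mult continuous_on_minus continuous_on_const assms)+)

lemma M_hat_mult_vec:
  "M_hat \<kappa> \<alpha> u *v v = A_hat \<kappa> \<alpha> u *v (\<chi> i. u $ i * v $ i)"
proof -
  have "(\<chi> i j. if i = j then u $ i else 0) *v v = (\<chi> i. u $ i * v $ i)"
    by (simp add: matrix_vector_mult_def vec_eq_iff if_distrib[where f = "\<lambda>x. x * _"] cong: if_cong)
  then show ?thesis by (simp add: M_hat_def matrix_vector_mul_assoc[symmetric])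
qed

locale mobility =
  fixes \<kappa> :: "'n::finite \<Rightarrow> 'n \<Rightarrow> real"
  assumes two_species: "CARD('n) \<ge> 2"
    and sym: "\<And>i j. i \<noteq> j \<Longrightarrow> \<kappa> i j = \<kappa> j i"
    and pos: "\<And>i j. i \<noteq> j \<Longrightarrow> \<kappa> i j > 0"
begin

abbreviation "\<kappa>\<^sub>0 \<equiv> kappa_min \<kappa>"
abbreviation "A \<equiv> A_shift \<kappa>"

lemma finite_offdiag: "finite {\<kappa> i j | i j. i \<noteq> j}"
  by (rule finite_subset[of _ "range (\<lambda>(i, j). \<kappa> i j)"]) auto

lemma kappa_min_pos: "0 < \<kappa>\<^sub>0"
proof -
  obtain i j :: 'n where "i \<noteq> j"
    using two_species card_le_Suc0_iff_eq[of "UNIV :: 'n set"] by force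
  then have "{\<kappa> i j | i j. i \<noteq> j} \<noteq> {}" by blast
  then have "\<kappa>\<^sub>0 \<in> {\<kappa> i j | i j. i \<noteq> j}"
    unfolding kappa_min_def using finite_offdiag by (rule Min_in[rotated])
  then show ?thesis using pos by auto
qed

lemma kappa_min_le: "i \<noteq> j \<Longrightarrow> \<kappa>\<^sub>0 \<le> \<kappa> i j"
  unfolding kappa_min_def using finite_offdiag by (intro Min_le) auto

lemma antisymmetric_sum_zero:
  assumes "\<And>i k. f i k = - f k i"
  shows "(\<Sum>i\<in>UNIV. \<Sum>k\<in>UNIV. (\<kappa> i k - \<kappa>\<^sub>0) * f i k) = 0" (is "?S = 0")
proof -
  have "(\<kappa> i k - \<kappa>\<^sub>0) * f i k = - ((\<kappa> k i - \<kappa>\<^sub>0) * f k i)" for i k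
  proof (cases "i = k")
    case True
    then show ?thesis using assms[of i i] by simp
  next
    case False
    then show ?thesis using assms[of i k] sym[of i k] by simp
  qed
  then have "?S = (\<Sum>i\<in>UNIV. \<Sum>k\<in>UNIV. - ((\<kappa> k i - \<kappa>\<^sub>0) * f k i))"
    by (intro sum.cong refl)
  also have "\<dots> = - ?S"
    by (subst sum.swap) (simp add: sum_negf)
  finally show ?thesis by simp
qed

lemma A_shift_total: "(\<Sum>i\<in>UNIV. (A u *v w) $ i) = \<kappa>\<^sub>0 * (\<Sum>i\<in>UNIV. w $ i)"
  using antisymmetric_sum_zero[of "\<lambda>i k. u $ k * w $ i - u $ i * w $ k"]
  by (simp add: A_shift_mult_vec sum.distrib sum_distrib_left)

text \<open>A species absent from an edge sees no cross-diffusion: its row is diagonal.  For the gas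
  phase this also describes the row of the inverse matrix.\<close>

lemma A_shift_row_at_zero:
  assumes "\<And>k. 0 \<le> u $ k" "u $ i = 0"
  obtains r where "0 < r" "\<And>w. (A u *v w) $ i = r * w $ i"
proof
  have "0 \<le> (\<kappa> i k - \<kappa>\<^sub>0) * u $ k" for k
    using assms kappa_min_le[of i k] by (cases "i = k") auto
  then have "0 \<le> (\<Sum>k\<in>UNIV. (\<kappa> i k - \<kappa>\<^sub>0) * u $ k)"
    by (intro sum_nonneg) auto
  then show "0 < \<kappa>\<^sub>0 + (\<Sum>k\<in>UNIV. (\<kappa> i k - \<kappa>\<^sub>0) * u $ k)"
    using kappa_min_pos by linarith
  show "(A u *v w) $ i = (\<kappa>\<^sub>0 + (\<Sum>k\<in>UNIV. (\<kappa> i k - \<kappa>\<^sub>0) * u $ k)) * w $ i" for w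
    using assms(2) by (simp add: A_shift_mult_vec distrib_right sum_distrib_right mult.assoc)
qed

text \<open>The transposed matrix is diagonally dominant: the exchange terms, tested with the
  signs of \<open>w\<close>, are bounded below by those of \<open>\<bar>w\<bar>\<close>, which cancel in the sum.\<close>

lemma A_shift_l1_coercive:
  assumes "\<And>k. 0 \<le> u $ k"
  shows "\<kappa>\<^sub>0 * (\<Sum>i\<in>UNIV. \<bar>w $ i\<bar>) \<le> (\<Sum>i\<in>UNIV. sgn (w $ i) * (A u *v w) $ i)"
proof -
  have term_le: "(\<kappa> i k - \<kappa>\<^sub>0) * (u $ k * \<bar>w $ i\<bar> - u $ i * \<bar>w $ k\<bar>)
      \<le> (\<kappa> i k - \<kappa>\<^sub>0) * (sgn (w $ i) * (u $ k * w $ i - u $ i * w $ k))" for i k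
  proof (cases "i = k")
    case False
    have "sgn (w $ i) * w $ k \<le> \<bar>w $ k\<bar>"
      by (simp add: sgn_real_def abs_le_iff) linarith
    then have "u $ i * (sgn (w $ i) * w $ k) \<le> u $ i * \<bar>w $ k\<bar>"
      using assms mult_left_mono by blast
    moreover have "sgn (w $ i) * w $ i = \<bar>w $ i\<bar>"
      by (simp add: sgn_real_def)
    then have "sgn (w $ i) * (u $ k * w $ i - u $ i * w $ k)
        = u $ k * \<bar>w $ i\<bar> - u $ i * (sgn (w $ i) * w $ k)"
      by (metis right_diff_distrib mult.left_commute)
    ultimately have "u $ k * \<bar>w $ i\<bar> - u $ i * \<bar>w $ k\<bar> \<le> sgn (w $ i) * (u $ k * w $ i - u $ i * w $ k)"
      by linarith
    then show ?thesis
      using kappa_min_le[OF False] by (intro mult_left_mono) auto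
  qed simp
  have "\<kappa>\<^sub>0 * (\<Sum>i\<in>UNIV. \<bar>w $ i\<bar>) = (\<Sum>i\<in>UNIV. \<kappa>\<^sub>0 * \<bar>w $ i\<bar>
      + (\<Sum>k\<in>UNIV. (\<kappa> i k - \<kappa>\<^sub>0) * (u $ k * \<bar>w $ i\<bar> - u $ i * \<bar>w $ k\<bar>)))"
    using antisymmetric_sum_zero[of "\<lambda>i k. u $ k * \<bar>w $ i\<bar> - u $ i * \<bar>w $ k\<bar>"]
    by (simp add: sum.distrib sum_distrib_left)
  also have "\<dots> \<le> (\<Sum>i\<in>UNIV. sgn (w $ i) * (A u *v w) $ i)"
  proof (rule sum_mono)
    fix i
    have "sgn (w $ i) * (A u *v w) $ i = \<kappa>\<^sub>0 * \<bar>w $ i\<bar>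
      + (\<Sum>k\<in>UNIV. (\<kappa> i k - \<kappa>\<^sub>0) * (sgn (w $ i) * (u $ k * w $ i - u $ i * w $ k)))"
      by (simp add: A_shift_mult_vec distrib_left sum_distrib_left mult.left_commute abs_sgn mult.commute)
    then show "\<kappa>\<^sub>0 * \<bar>w $ i\<bar> + (\<Sum>k\<in>UNIV. (\<kappa> i k - \<kappa>\<^sub>0) * (u $ k * \<bar>w $ i\<bar> - u $ i * \<bar>w $ k\<bar>))
        \<le> sgn (w $ i) * (A u *v w) $ i"
      using term_le by (simp add: sum_mono)
  qed
  finally show ?thesis .
qed

lemma A_shift_invertible:
  assumes "\<And>k. 0 \<le> u $ k"
  shows "invertible (A u)"
proof -
  have "w = 0" if "A u *v w = 0" for w
  proof -
    have "(\<Sum>i\<in>UNIV. \<bar>w $ i\<bar>) \<le> 0"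
      using A_shift_l1_coercive[OF assms, of w] that kappa_min_pos by (simp add: mult_le_0_iff)
    then have "(\<Sum>i\<in>UNIV. \<bar>w $ i\<bar>) = 0"
      by (intro antisym sum_nonneg) auto
    then have "\<forall>i. w $ i = 0"
      by (simp add: sum_nonneg_eq_0_iff)
    then show ?thesis by (simp add: vec_eq_iff)
  qed
  then show ?thesis
    using matrix_left_invertible_ker[of "A u"] invertible_left_inverse[of "A u"] by blast
qed

text \<open>The exchange terms combine to
  \<open>1/2 \<Sum>\<^sub>i\<^sub>k (\<kappa>\<^sub>i\<^sub>k - \<kappa>\<^sub>0) u\<^sub>i u\<^sub>k (v\<^sub>i - v\<^sub>k)\<^sup>2\<close>.\<close>

lemma A_shift_diag_nonneg:
  assumes "\<And>k. 0 \<le> u $ k"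
  shows "0 \<le> v \<bullet> (A u *v (\<chi> i. u $ i * v $ i))"
proof -
  define b where "b i k = (\<kappa> i k - \<kappa>\<^sub>0) * (u $ i * u $ k)" for i k
  have b: "b i k = b k i" "0 \<le> b i k * (v $ i - v $ k)\<^sup>2" for i k
    using assms sym[of i k] kappa_min_le[of i k] by (cases "i = k"; simp add: b_def)+
  have "(\<Sum>i\<in>UNIV. \<Sum>k\<in>UNIV. b i k * (v $ i - v $ k) * v $ i)
      = (\<Sum>i\<in>UNIV. \<Sum>k\<in>UNIV. b k i * (v $ k - v $ i) * v $ k)"
    by (rule sum.swap)
  then have "2 * (\<Sum>i\<in>UNIV. \<Sum>k\<in>UNIV. b i k * (v $ i - v $ k) * v $ i)
      = (\<Sum>i\<in>UNIV. \<Sum>k\<in>UNIV. b i k * (v $ i - v $ k) * v $ i)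
        + (\<Sum>i\<in>UNIV. \<Sum>k\<in>UNIV. b k i * (v $ k - v $ i) * v $ k)"
    by simp
  also have "\<dots> = (\<Sum>i\<in>UNIV. \<Sum>k\<in>UNIV. b i k * (v $ i - v $ k)\<^sup>2)"
  proof -
    have "b i k * (v $ i - v $ k) * v $ i + b k i * (v $ k - v $ i) * v $ k
        = b i k * (v $ i - v $ k)\<^sup>2" for i k
      unfolding b(1)[of k i] by (simp add: power2_eq_square algebra_simps)
    then show ?thesis by (simp add: sum.distrib[symmetric])
  qed
  finally have "0 \<le> (\<Sum>i\<in>UNIV. \<Sum>k\<in>UNIV. b i k * (v $ i - v $ k) * v $ i)"
    using b(2) by (smt (verit) sum_nonneg)
  moreover have "v $ i * (A u *v (\<chi> i. u $ i * v $ i)) $ i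
      = \<kappa>\<^sub>0 * (u $ i * (v $ i)\<^sup>2) + (\<Sum>k\<in>UNIV. b i k * (v $ i - v $ k) * v $ i)" for i
  proof -
    have term_eq: "(\<kappa> i k - \<kappa>\<^sub>0) * (u $ k * (u $ i * v $ i) - u $ i * (u $ k * v $ k)) = b i k * (v $ i - v $ k)" for k
      unfolding b_def by algebra
    show ?thesis
      unfolding A_shift_mult_vec vec_lambda_beta term_eq sum_distrib_right[symmetric] by algebra
  qed
  then have "v \<bullet> (A u *v (\<chi> i. u $ i * v $ i)) = \<kappa>\<^sub>0 * (\<Sum>i\<in>UNIV. u $ i * (v $ i)\<^sup>2)
      + (\<Sum>i\<in>UNIV. \<Sum>k\<in>UNIV. b i k * (v $ i - v $ k) * v $ i)"
    by (simp add: inner_vec_def sum.distrib sum_distrib_left)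
  moreover have "0 \<le> \<kappa>\<^sub>0 * (\<Sum>i\<in>UNIV. u $ i * (v $ i)\<^sup>2)"
    using assms kappa_min_pos by (intro mult_nonneg_nonneg sum_nonneg) auto
  ultimately show ?thesis by linarith
qed

text \<open>With \<open>w = A\<^sup>-\<^sup>1 diag(u) v = diag(u) z\<close>, the form of the inverse at \<open>v\<close> is the form
  of the matrix itself at \<open>z\<close>.\<close>

lemma A_shift_inv_diag_nonneg:
  assumes "\<And>k. 0 < u $ k"
  shows "0 \<le> v \<bullet> (matrix_inv (A u) *v (\<chi> i. u $ i * v $ i))"
proof -
  define w where "w = matrix_inv (A u) *v (\<chi> i. u $ i * v $ i)"
  define z :: "real^'n" where "z = (\<chi> i. w $ i / u $ i)"
  have u0: "0 \<le> u $ k" for k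
    using assms[of k] by simp
  have wz: "w = (\<chi> i. u $ i * z $ i)"
    using assms by (simp add: z_def vec_eq_iff less_imp_neq[symmetric])
  have "A u *v w = (\<chi> i. u $ i * v $ i)"
    using matrix_inv_mult_right[OF A_shift_invertible[OF u0]]
    by (simp add: w_def matrix_vector_mul_assoc)
  then have "v \<bullet> w = z \<bullet> (A u *v w)"
    using wz by (simp add: inner_vec_def mult_ac)
  then show ?thesis
    using A_shift_diag_nonneg[OF u0, of z] wz by (simp add: w_def)
qed

end


section \<open>Interface and mesh sums\<close>

text \<open>Rounding \<open>N X\<close> to the nearest integer gives an edge at distance at most \<open>\<Delta>x / 2\<close>, and the
  interface index does no worse.\<close>

lemma iface_le_and_close:
  assumes "1 \<le> N" "X \<in> {0..1}"
  shows "iface N X \<le> N \<and> \<bar>xedge N (iface N X) - X\<bar> \<le> dx N / 2"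
proof -
  have "\<exists>K. is_arg_min (\<lambda>L. \<bar>xedge N L - X\<bar>) (\<lambda>L. L \<le> N) K"
    using ex_is_arg_min_if_finite[of "{..N}" "\<lambda>L. \<bar>xedge N L - X\<bar>"] by (simp add: atMost_def) blast
  then have arg_min: "is_arg_min (\<lambda>L. \<bar>xedge N L - X\<bar>) (\<lambda>L. L \<le> N) (iface N X)"
    unfolding iface_def by (rule LeastI_ex)
  define L where "L = nat \<lfloor>X * real N + 1 / 2\<rfloor>"
  have "0 \<le> X * real N" "X * real N \<le> real N"
    using assms mult_right_mono[of X 1 "real N"] by auto
  moreover from this have "real L = of_int \<lfloor>X * real N + 1 / 2\<rfloor>"
    by (simp add: L_def)
  ultimately have L: "\<bar>real L - X * real N\<bar> \<le> 1 / 2" "L \<le> N"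
    by linarith+
  have "xedge N L - X = (real L - X * real N) / real N"
    using assms by (simp add: xedge_def dx_def field_simps)
  moreover have "\<bar>real L - X * real N\<bar> / real N \<le> (1 / 2) / real N"
    using L(1) by (intro divide_right_mono) auto
  ultimately have "\<bar>xedge N L - X\<bar> \<le> dx N / 2"
    by (simp add: abs_divide dx_def)
  moreover have "\<bar>xedge N (iface N X) - X\<bar> \<le> \<bar>xedge N L - X\<bar>"
    using arg_min L(2) by (auto simp: is_arg_min_def not_less)
  ultimately show ?thesis
    using arg_min by (auto simp: is_arg_min_def)
qed

lemma sqrt_beta_pos: "0 < sqrt (beta \<mu> i)"
  by (simp add: beta_def)

text \<open>\<open>2 cosh\<close> of half the potential difference is \<open>\<surd>\<beta> + 1 / \<surd>\<beta>\<close>, a sum of two positive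
  terms.\<close>

lemma sqrt_beta_le_speed:
  "sqrt (beta \<mu> i) \<le> speed_bound \<mu> \<and> 1 / sqrt (beta \<mu> i) \<le> speed_bound \<mu>"
proof -
  define d where "d = \<mu> Gas $ i - \<mu> Solid $ i"
  have "sqrt (beta \<mu> i) = exp (d / 2)"
    by (intro real_sqrt_unique) (simp_all add: beta_def d_def exp_double[symmetric])
  then have "sqrt (beta \<mu> i) + 1 / sqrt (beta \<mu> i) = 2 * cosh (1 / 2 * d)"
    by (simp add: cosh_def exp_minus inverse_eq_divide)
  moreover have "2 * cosh (1 / 2 * d) \<le> speed_bound \<mu>"
    unfolding speed_bound_def d_def by (intro Max_ge) auto
  moreover have "0 < 1 / sqrt (beta \<mu> i)"
    using sqrt_beta_pos[of \<mu> i] by simp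
  ultimately show ?thesis
    using sqrt_beta_pos[of \<mu> i] by linarith
qed

text \<open>Remeshing alters at most three consecutive cells, so sums over the mesh are compared on
  these three cells.\<close>

lemma sum_le_of_agree_outside_three:
  fixes f g :: "nat \<Rightarrow> real"
  assumes "1 \<le> j" "j + 2 \<le> N"
    and "\<And>K. K \<in> {1..N} - {j, j + 1, j + 2} \<Longrightarrow> f K = g K"
    and "f j + f (j + 1) + f (j + 2) \<le> g j + g (j + 1) + g (j + 2)"
  shows "(\<Sum>K=1..N. f K) \<le> (\<Sum>K=1..N. g K)"
proof -
  have split: "(\<Sum>K=1..N. f K) = f j + f (j + 1) + f (j + 2) + sum f ({1..N} - {j, j + 1, j + 2})"
    for f :: "nat \<Rightarrow> real"
    using sum.subset_diff[of "{j, j + 1, j + 2}" "{1..N}" f] assms(1,2) by simp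
  have "sum f ({1..N} - {j, j + 1, j + 2}) = sum g ({1..N} - {j, j + 1, j + 2})"
    using assms(3) by (rule sum.cong[OF refl])
  then show ?thesis
    using assms(4) unfolding split by linarith
qed

lemma sum_eq_of_agree_outside_three:
  fixes f g :: "nat \<Rightarrow> real"
  assumes "1 \<le> j" "j + 2 \<le> N"
    and "\<And>K. K \<in> {1..N} - {j, j + 1, j + 2} \<Longrightarrow> f K = g K"
    and "f j + f (j + 1) + f (j + 2) = g j + g (j + 1) + g (j + 2)"
  shows "(\<Sum>K=1..N. f K) = (\<Sum>K=1..N. g K)"
  using assms by (intro antisym sum_le_of_agree_outside_three) auto

lemma summation_by_parts:
  fixes g J :: "nat \<Rightarrow> real"
  assumes "J 0 = 0" "J N = 0"
  shows "(\<Sum>K=1..N. g K * (J K - J (K - 1))) = - (\<Sum>K\<in>{1..N - 1}. (g (K + 1) - g K) * J K)"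
proof -
  have "(\<Sum>K=1..n. g K * (J K - J (K - 1))) = g n * J n - (\<Sum>K\<in>{1..n - 1}. (g (K + 1) - g K) * J K)" for n
  proof (induction n)
    case 0
    then show ?case using assms by simp
  next
    case (Suc n)
    then show ?case using assms(1) by (cases n) (simp_all add: algebra_simps)
  qed
  then show ?thesis using assms by simp
qed

section \<open>Convexity of the energy density\<close>

lemma energy_density_tangent:
  assumes a: "\<And>i. 0 < a $ i" and b: "\<And>i. 0 \<le> b $ i"
  shows "energy_density \<mu> \<alpha> a - energy_density \<mu> \<alpha> b
    \<le> (\<Sum>i\<in>UNIV. (ln (a $ i) + \<mu> \<alpha> $ i) * (a $ i - b $ i))"
proof -
  have "b $ i * ln (a $ i) - b $ i * ln (b $ i) \<le> a $ i - b $ i" for i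
  proof (cases "b $ i = 0")
    case True
    then show ?thesis using a[of i] by simp
  next
    case False
    then have "0 < b $ i" using b[of i] by simp
    then have "b $ i * ln (a $ i / b $ i) \<le> b $ i * (a $ i / b $ i - 1)"
      using a[of i] by (intro mult_left_mono ln_le_minus_one) simp_all
    then show ?thesis
      using a[of i] \<open>0 < b $ i\<close> by (simp add: ln_div right_diff_distrib)
  qed
  then have "(a $ i * (ln (a $ i) + \<mu> \<alpha> $ i) - a $ i + 1) - (b $ i * (ln (b $ i) + \<mu> \<alpha> $ i) - b $ i + 1)
      \<le> (ln (a $ i) + \<mu> \<alpha> $ i) * (a $ i - b $ i)" for i
    by (simp add: algebra_simps)
  then show ?thesis
    unfolding energy_density_def sum_subtractf[symmetric] by (intro sum_mono) auto
qed

text \<open>The tangent inequality for a cell whose size changes from \<open>s\<^sub>0\<close> to \<open>s\<close>.  The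
  contribution of the size change is \<open>(s - s\<^sub>0) (h(a) - \<nabla>h(a) \<bullet> a)\<close>, and the bracket is
  \<open>\<Sum>\<^sub>i (1 - a\<^sub>i)\<close>, which for a vector of total one depends neither on the vector nor on the
  phase.\<close>

lemma energy_density_resized_cell:
  fixes a b :: "real^'n"
  assumes a: "\<And>i. 0 < a $ i" "(\<Sum>i\<in>UNIV. a $ i) = 1" and b: "\<And>i. 0 \<le> b $ i" and "0 \<le> s\<^sub>0"
  shows "s * energy_density \<mu> \<alpha> a - s\<^sub>0 * energy_density \<mu> \<alpha> b
    \<le> (\<Sum>i\<in>UNIV. (ln (a $ i) + \<mu> \<alpha> $ i) * (s * a $ i - s\<^sub>0 * b $ i)) + (s - s\<^sub>0) * (CARD('n) - 1)"
proof -
  let ?g = "\<lambda>i. ln (a $ i) + \<mu> \<alpha> $ i"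
  define E where "E = (\<Sum>i\<in>UNIV. ?g i * a $ i)"
  define D where "D = (\<Sum>i\<in>UNIV. ?g i * (a $ i - b $ i))"
  define e where "e = energy_density \<mu> \<alpha> b"
  have ea: "energy_density \<mu> \<alpha> a = E + (CARD('n) - 1)"
    using a(2) by (simp add: E_def energy_density_def sum.distrib sum_subtractf mult.commute)
  have "s\<^sub>0 * (energy_density \<mu> \<alpha> a - e) \<le> s\<^sub>0 * D"
    unfolding D_def e_def using energy_density_tangent[OF a(1) b] \<open>0 \<le> s\<^sub>0\<close> by (intro mult_left_mono)
  moreover have "(\<Sum>i\<in>UNIV. ?g i * (s * a $ i - s\<^sub>0 * b $ i)) = s\<^sub>0 * D + (s - s\<^sub>0) * E"
    unfolding D_def E_def sum_distrib_left sum.distrib[symmetric] by (intro sum.cong refl) algebra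
  ultimately show ?thesis
    unfolding ea e_def[symmetric] by (simp add: algebra_simps)
qed

text \<open>Jensen's inequality for two cells, from the tangents at the average.\<close>

lemma energy_density_average:
  fixes a b :: "real^'n"
  assumes "\<And>i. 0 < a $ i" "\<And>i. 0 < b $ i" "0 < s" "0 < t"
  defines "v \<equiv> (1 / (s + t)) *\<^sub>R (s *\<^sub>R a + t *\<^sub>R b)"
  shows "(s + t) * energy_density \<mu> \<alpha> v \<le> s * energy_density \<mu> \<alpha> a + t * energy_density \<mu> \<alpha> b"
proof -
  let ?g = "\<lambda>i. ln (v $ i) + \<mu> \<alpha> $ i"
  have v: "0 < v $ i" "(s + t) * v $ i = s * a $ i + t * b $ i" for i
    using assms(1,2)[of i] assms(3,4) by (simp_all add: v_def add_pos_pos)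
  have "s * (energy_density \<mu> \<alpha> v - energy_density \<mu> \<alpha> a)
      \<le> s * (\<Sum>i\<in>UNIV. ?g i * (v $ i - a $ i))"
    "t * (energy_density \<mu> \<alpha> v - energy_density \<mu> \<alpha> b)
      \<le> t * (\<Sum>i\<in>UNIV. ?g i * (v $ i - b $ i))"
    using assms v(1) by (intro mult_left_mono energy_density_tangent less_imp_le; simp)+
  moreover have "s * (\<Sum>i\<in>UNIV. ?g i * (v $ i - a $ i)) + t * (\<Sum>i\<in>UNIV. ?g i * (v $ i - b $ i))
      = (\<Sum>i\<in>UNIV. ?g i * ((s + t) * v $ i - (s * a $ i + t * b $ i)))"
    unfolding sum_distrib_left sum.distrib[symmetric] by (intro sum.cong refl) algebra
  then have "s * (\<Sum>i\<in>UNIV. ?g i * (v $ i - a $ i)) + t * (\<Sum>i\<in>UNIV. ?g i * (v $ i - b $ i)) = 0"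
    using v(2) by simp
  ultimately show ?thesis
    by (simp add: algebra_simps)
qed

lemma average_in_simplex:
  fixes a b :: "real^'n"
  assumes "\<And>i. 0 < a $ i" "\<And>i. 0 < b $ i" "(\<Sum>i\<in>UNIV. a $ i) = 1" "(\<Sum>i\<in>UNIV. b $ i) = 1"
    and "0 < s" "0 < t"
  defines "v \<equiv> (1 / (s + t)) *\<^sub>R (s *\<^sub>R a + t *\<^sub>R b)"
  shows "0 < v $ i" "(\<Sum>i\<in>UNIV. v $ i) = 1" "(s + t) * v $ i = s * a $ i + t * b $ i"
proof -
  show "0 < v $ i" "(s + t) * v $ i = s * a $ i + t * b $ i"
    using assms(1,2)[of i] assms(5,6) by (simp_all add: v_def add_pos_pos)
  have "(\<Sum>i\<in>UNIV. v $ i) = (s * (\<Sum>i\<in>UNIV. a $ i) + t * (\<Sum>i\<in>UNIV. b $ i)) / (s + t)"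
    by (simp add: v_def sum_divide_distrib[symmetric] sum.distrib sum_distrib_left)
  then show "(\<Sum>i\<in>UNIV. v $ i) = 1"
    using assms(3-6) by simp
qed


section \<open>One time step: geometry of the moving cell edge\<close>

locale stefan_step =
  fixes \<kappa> :: "phase \<Rightarrow> 'n::finite \<Rightarrow> 'n \<Rightarrow> real"
    and \<mu> :: "phase \<Rightarrow> real^'n"
    and N :: nat and dt X0 :: real
    and c0 :: "nat \<Rightarrow> real^'n"
  assumes two_species: "CARD('n) \<ge> 2"
    and \<kappa>_sym: "\<And>\<alpha> i j. i \<noteq> j \<Longrightarrow> \<kappa> \<alpha> i j = \<kappa> \<alpha> j i"
    and \<kappa>_pos: "\<And>\<alpha> i j. i \<noteq> j \<Longrightarrow> \<kappa> \<alpha> i j > 0"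
    and dt_pos: "0 < dt" and dt_less: "dt < dx N / (2 * speed_bound \<mu>)"
    and c0_nonneg: "\<And>i K. K \<in> {1..N} \<Longrightarrow> c0 K $ i \<ge> 0"
    and c0_total: "\<And>K. K \<in> {1..N} \<Longrightarrow> (\<Sum>i\<in>UNIV. c0 K $ i) = 1"
    and X0_unit: "X0 \<in> {0..1}"
    and iface_gt: "1 < iface N X0" and iface_less: "iface N X0 < N"
    and mass_pos: "\<And>i. (\<Sum>K=1..N. cell_size_at N X0 K * c0 K $ i) > 0"
begin

sublocale mob: mobility "\<kappa> \<alpha>" for \<alpha>
  using two_species \<kappa>_sym \<kappa>_pos by unfold_locales auto

abbreviation "m \<equiv> iface N X0"
abbreviation "h \<equiv> dx N"
abbreviation "F \<equiv> iface_flux \<mu> m"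

lemma N_ge: "3 \<le> N"
  using iface_gt iface_less by simp

lemma h_pos: "0 < h"
  using N_ge by (simp add: dx_def)

text \<open>The admissible guesses.  Cells outside the mesh, whose values never enter the scheme, are
  constrained as well; this saves index conditions on edge values and jumps.\<close>

definition S :: "(nat \<Rightarrow> real^'n) set" where
  "S = {c. \<forall>K. (\<forall>i. 0 \<le> c K $ i) \<and> (\<Sum>i\<in>UNIV. c K $ i) = 1}"

text \<open>The interface position that the law of the scheme assigns to a guess, so that only the
  balance equations of the cells remain to be solved.\<close>

definition X_new :: "(nat \<Rightarrow> real^'n) \<Rightarrow> real" where
  "X_new c = X0 + dt * (\<Sum>i\<in>UNIV. F c $ i)"

definition flux :: "(nat \<Rightarrow> real^'n) \<Rightarrow> nat \<Rightarrow> real^'n" where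
  "flux c K = (if K = 0 \<or> N \<le> K then 0 else if K = m then - F c
     else - (1 / h) *\<^sub>R (A_hat \<kappa> (cell_phase N X0 K) (edge_conc c K) *v jump c K))"

definition defect :: "(nat \<Rightarrow> real^'n) \<Rightarrow> nat \<Rightarrow> real^'n" where
  "defect c K = cell_size N m (X_new c) K *\<^sub>R c K - cell_size_at N X0 K *\<^sub>R c0 K
     + dt *\<^sub>R (flux c K - flux c (K - 1))"

lemma S_nonneg: "c \<in> S \<Longrightarrow> 0 \<le> c K $ i" and S_total: "c \<in> S \<Longrightarrow> (\<Sum>i\<in>UNIV. c K $ i) = 1"
  by (auto simp: S_def)

lemma edge_conc_nonneg: "c \<in> S \<Longrightarrow> 0 \<le> edge_conc c K $ i"
  by (simp add: edge_conc_def log_mean_nonneg S_nonneg)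

text \<open>The speed is a difference of two weighted means of numbers in
  \<open>[0, speed_bound \<mu>]\<close>.\<close>

lemma interface_speed_bound:
  assumes "c \<in> S"
  shows "\<bar>\<Sum>i\<in>UNIV. F c $ i\<bar> \<le> speed_bound \<mu>"
proof -
  have avg: "0 \<le> (\<Sum>i\<in>UNIV. w i * c K $ i) \<and> (\<Sum>i\<in>UNIV. w i * c K $ i) \<le> speed_bound \<mu>"
    if "\<And>i. 0 \<le> w i \<and> w i \<le> speed_bound \<mu>" for w :: "'n \<Rightarrow> real" and K
  proof -
    have "(\<Sum>i\<in>UNIV. w i * c K $ i) \<le> (\<Sum>i\<in>UNIV. speed_bound \<mu> * c K $ i)"
      using that S_nonneg[OF assms] by (intro sum_mono mult_right_mono) auto
    then show ?thesis
      using that S_nonneg[OF assms] S_total[OF assms]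
      by (auto simp: sum_distrib_left[symmetric] intro!: sum_nonneg)
  qed
  have "(\<Sum>i\<in>UNIV. F c $ i) = (\<Sum>i\<in>UNIV. sqrt (beta \<mu> i) * c (m + 1) $ i)
      - (\<Sum>i\<in>UNIV. 1 / sqrt (beta \<mu> i) * c m $ i)"
    by (simp add: iface_flux_def sum_subtractf)
  moreover have "0 \<le> sqrt (beta \<mu> i)" "0 \<le> 1 / sqrt (beta \<mu> i)" for i
    using sqrt_beta_pos[of \<mu> i] by simp_all
  ultimately show ?thesis
    using avg[of "\<lambda>i. sqrt (beta \<mu> i)" "m + 1"] avg[of "\<lambda>i. 1 / sqrt (beta \<mu> i)" m]
      sqrt_beta_le_speed[of \<mu>] by fastforce
qed

lemma X0_close: "\<bar>real m * h - X0\<bar> \<le> h / 2"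
  using iface_le_and_close[of N X0] N_ge X0_unit by (simp add: xedge_def)

lemma X_new_close:
  assumes "c \<in> S"
  shows "\<bar>X_new c - real m * h\<bar> < h"
proof -
  have speed_pos: "0 < speed_bound \<mu>"
    using sqrt_beta_le_speed sqrt_beta_pos less_le_trans by blast
  have "\<bar>X_new c - X0\<bar> = dt * \<bar>\<Sum>i\<in>UNIV. F c $ i\<bar>"
    using dt_pos by (simp add: X_new_def abs_mult)
  also have "\<dots> \<le> dt * speed_bound \<mu>"
    using interface_speed_bound[OF assms] dt_pos by (intro mult_left_mono) auto
  also have "\<dots> < h / 2"
    using dt_less speed_pos by (simp add: field_simps)
  finally show ?thesis
    using X0_close by linarith
qed

lemma X_new_unit:
  assumes "c \<in> S"
  shows "X_new c \<in> {0..1}"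
proof -
  have "2 * h \<le> real m * h" "real (m + 1) * h \<le> real N * h"
    using iface_gt iface_less h_pos by (intro mult_right_mono; simp)+
  moreover have "real N * h = 1"
    using N_ge by (simp add: dx_def)
  moreover have "real (m + 1) * h = real m * h + h"
    by (simp add: distrib_right)
  ultimately show ?thesis
    using X_new_close[OF assms] h_pos unfolding atLeastAtMost_iff abs_less_iff by linarith
qed

lemma cell_size_pos:
  assumes "\<bar>X - real m * h\<bar> < h"
  shows "0 < cell_size N m X K"
proof -
  have "real (m - 1) = real m - 1"
    using iface_gt by simp
  then show ?thesis
    using assms h_pos by (auto simp: cell_size_def xedge_def algebra_simps abs_less_iff)
qed

lemma cell_size_old_pos: "0 < cell_size_at N X0 K"
  using cell_size_pos[of X0 K] X0_close h_pos by (simp add: cell_size_at_def abs_minus_commute)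

lemma sum_cell_size: "(\<Sum>K=1..N. cell_size N m X K) = (\<Sum>K=1..N. cell_size N m X' K)"
  using iface_gt iface_less by (intro sum_eq_of_agree_outside_three[of "m - 1"]) (auto simp: cell_size_def)

section \<open>Fluxes and the defect of the scheme\<close>

lemma flux_total:
  assumes "c \<in> S"
  shows "(\<Sum>i\<in>UNIV. flux c K $ i) = (if K = m then - (\<Sum>i\<in>UNIV. F c $ i) else 0)"
proof -
  have "(\<Sum>i\<in>UNIV. jump c K $ i) = 0"
    using S_total[OF assms] by (simp add: jump_def sum_subtractf)
  moreover have "(\<Sum>i\<in>UNIV. (A_hat \<kappa> \<alpha> (edge_conc c K) *v w) $ i) = 0"
    if "(\<Sum>i\<in>UNIV. w $ i) = 0" for \<alpha> w
  proof (cases \<alpha>)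
    case Solid
    then show ?thesis using that mob.A_shift_total by (simp add: A_hat_def)
  next
    case Gas
    let ?A = "A_shift (\<kappa> Gas) (edge_conc c K)"
    have "?A *v (matrix_inv ?A *v w) = w"
      using matrix_inv_mult_right[OF mob.A_shift_invertible[of "edge_conc c K" Gas]]
        edge_conc_nonneg[OF assms] by (simp add: matrix_vector_mul_assoc)
    then show ?thesis
      using that mob.A_shift_total[of Gas "edge_conc c K" "matrix_inv ?A *v w"]
        mob.kappa_min_pos[of Gas] Gas by (simp add: A_hat_def)
  qed
  ultimately show ?thesis
    using iface_gt iface_less by (simp add: flux_def sum_negf sum_divide_distrib[symmetric])
qed

text \<open>The sign structure behind quasi-positivity and behind strict positivity.  If a species is
  missing on one side of an edge, its flux through this edge is a genuine two-point flux; in the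
  bulk because the row of the mobility matrix is diagonal, at the interface by definition.\<close>

lemma flux_at_zero:
  assumes c: "c \<in> S" and K: "1 \<le> K" "K < N" and zero: "c K $ i = 0 \<or> c (K + 1) $ i = 0"
  obtains a b where "0 < a" "0 < b" "flux c K $ i = a * c K $ i - b * c (K + 1) $ i"
proof (cases "K = m")
  case True
  show thesis
    using K sqrt_beta_pos[of \<mu> i]
    by (intro that[of "1 / sqrt (beta \<mu> i)" "sqrt (beta \<mu> i)"]) (simp_all add: flux_def iface_flux_def True)
next
  case False
  let ?u = "edge_conc c K"
  have u: "?u $ i = 0"
    using zero S_nonneg[OF c] by (auto simp: edge_conc_def log_mean_def min_def)
  show thesis
  proof (cases "cell_phase N X0 K")
    case Solid
    obtain r where "0 < r" and r: "\<And>w. (A_shift (\<kappa> Solid) ?u *v w) $ i = r * w $ i"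
      using mob.A_shift_row_at_zero[of ?u i] edge_conc_nonneg[OF c] u by metis
    then show thesis
      using K False h_pos Solid
      by (intro that[of "r / h" "r / h"]) (simp_all add: flux_def A_hat_def jump_def field_simps)
  next
    case Gas
    let ?A = "A_shift (\<kappa> Gas) ?u"
    obtain r where "0 < r" and r: "\<And>w. (?A *v w) $ i = r * w $ i"
      using mob.A_shift_row_at_zero[of ?u i] edge_conc_nonneg[OF c] u by metis
    have "?A *v (matrix_inv ?A *v jump c K) = jump c K"
      using matrix_inv_mult_right[OF mob.A_shift_invertible[of ?u Gas]]
        edge_conc_nonneg[OF c] by (simp add: matrix_vector_mul_assoc)
    then have "r * (matrix_inv ?A *v jump c K) $ i = jump c K $ i"
      using r by metis
    then have "(matrix_inv ?A *v jump c K) $ i = (c (K + 1) $ i - c K $ i) / r"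
      using \<open>0 < r\<close> by (simp add: jump_def field_simps)
    then show thesis
      using K False h_pos Gas \<open>0 < r\<close>
      by (intro that[of "1 / (r * h)" "1 / (r * h)"]) (simp_all add: flux_def A_hat_def field_simps)
  qed
qed

lemma flux_boundary: "flux c 0 = 0" "flux c N = 0"
  by (simp_all add: flux_def)

lemma continuous_on_cell_entry: "continuous_on S (\<lambda>c. c K $ i)"
  by (intro continuous_on_component continuous_on_subset[OF continuous_on_product_coordinates]) simp

lemma continuous_on_edge_conc: "continuous_on S (\<lambda>c. edge_conc c K $ i)"
proof -
  have "continuous_on S (\<lambda>c. log_mean (fst (c K $ i, c (K + 1) $ i)) (snd (c K $ i, c (K + 1) $ i)))"
    by (rule continuous_on_compose2[OF continuous_on_log_mean])
      (auto intro!: continuous_on_Pair continuous_on_cell_entry simp: S_nonneg)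
  then show ?thesis by (simp add: edge_conc_def)
qed

lemma continuous_on_iface_flux: "continuous_on S (\<lambda>c. F c $ i)"
  by (simp add: iface_flux_def, intro continuous_on_diff continuous_on_mult continuous_on_divide
      continuous_on_const continuous_on_cell_entry) (simp add: beta_def)

lemma continuous_on_flux: "continuous_on S (\<lambda>c. flux c K $ i)"
proof -
  have jump: "continuous_on S (\<lambda>c. jump c K $ i)" for i
    by (simp add: jump_def, intro continuous_on_diff continuous_on_cell_entry)
  have "continuous_on S (\<lambda>c. (A_hat \<kappa> \<alpha> (edge_conc c K) *v jump c K) $ i)" for \<alpha>
    by (cases \<alpha>; simp add: A_hat_def)
      (intro continuous_on_matrix_mult continuous_on_matrix_inv_mult continuous_on_A_shift
        continuous_on_edge_conc jump mob.A_shift_invertible edge_conc_nonneg; assumption)+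
  then show ?thesis
    using continuous_on_iface_flux[of i] h_pos
    by (cases "K = 0 \<or> N \<le> K"; cases "K = m")
      (simp_all add: flux_def continuous_on_const, (intro continuous_on_minus continuous_on_divide continuous_on_const; simp)+)
qed

lemma continuous_on_defect: "continuous_on S (\<lambda>c. defect c K $ i)"
proof -
  have "continuous_on S X_new"
    unfolding X_new_def
    by (intro continuous_on_add continuous_on_mult continuous_on_const continuous_on_sum continuous_on_iface_flux)
  then have "continuous_on S (\<lambda>c. cell_size N m (X_new c) K)"
    by (cases "K = m"; cases "K = m + 1") (auto simp: cell_size_def intro!: continuous_intros)
  then show ?thesis
    by (simp add: defect_def, intro continuous_on_add continuous_on_diff continuous_on_mult
        continuous_on_const continuous_on_cell_entry continuous_on_flux)
qed

text \<open>In the two cells at the interface the change of size is compensated by the total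
  interface flux, because \<open>X_new\<close> follows the law of the interface.\<close>

lemma defect_total:
  assumes c: "c \<in> S" and K: "K \<in> {1..N}"
  shows "(\<Sum>i\<in>UNIV. defect c K $ i) = 0"
proof -
  have "(\<Sum>i\<in>UNIV. defect c K $ i) = cell_size N m (X_new c) K - cell_size N m X0 K
      + dt * ((\<Sum>i\<in>UNIV. flux c K $ i) - (\<Sum>i\<in>UNIV. flux c (K - 1) $ i))"
    using S_total[OF c] c0_total[OF K]
    by (simp add: defect_def sum.distrib sum_subtractf sum_distrib_left[symmetric] cell_size_at_def)
  then show ?thesis
    using K iface_gt unfolding flux_total[OF c]
    by (auto simp: cell_size_def X_new_def)
qed

lemma flux_right_at_zero:
  assumes "c \<in> S" "K \<in> {1..N}" "c K $ i = 0"
  shows "flux c K $ i \<le> 0" "flux c K $ i = 0 \<Longrightarrow> K < N \<Longrightarrow> c (K + 1) $ i = 0"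
proof -
  have "flux c K $ i \<le> 0 \<and> (flux c K $ i = 0 \<longrightarrow> K < N \<longrightarrow> c (K + 1) $ i = 0)"
  proof (cases "K = N")
    case False
    then obtain a b where "0 < b" "flux c K $ i = a * c K $ i - b * c (K + 1) $ i"
      using flux_at_zero[of c K i] assms by auto
    then show ?thesis using assms(3) S_nonneg[OF assms(1)] by simp
  qed (simp add: flux_boundary)
  then show "flux c K $ i \<le> 0" "flux c K $ i = 0 \<Longrightarrow> K < N \<Longrightarrow> c (K + 1) $ i = 0"
    by auto
qed

lemma flux_left_at_zero:
  assumes "c \<in> S" "K \<in> {1..N}" "c K $ i = 0"
  shows "0 \<le> flux c (K - 1) $ i" "flux c (K - 1) $ i = 0 \<Longrightarrow> 1 < K \<Longrightarrow> c (K - 1) $ i = 0"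
proof -
  have "0 \<le> flux c (K - 1) $ i \<and> (flux c (K - 1) $ i = 0 \<longrightarrow> 1 < K \<longrightarrow> c (K - 1) $ i = 0)"
  proof (cases "K = 1")
    case False
    then have "1 \<le> K - 1" "K - 1 < N" "K - 1 + 1 = K"
      using assms(2) by auto
    then obtain a b where "0 < a" "flux c (K - 1) $ i = a * c (K - 1) $ i - b * c K $ i"
      using flux_at_zero[of c "K - 1" i] assms by metis
    then show ?thesis using assms(3) S_nonneg[OF assms(1)] by simp
  qed (simp add: flux_boundary)
  then show "0 \<le> flux c (K - 1) $ i" "flux c (K - 1) $ i = 0 \<Longrightarrow> 1 < K \<Longrightarrow> c (K - 1) $ i = 0"
    by auto
qed

text \<open>The defect at an absent species is a sum of three nonpositive terms; the second claim is
  the case where all of them vanish.\<close>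

lemma defect_at_zero:
  assumes "c \<in> S" "K \<in> {1..N}" "c K $ i = 0"
  shows "defect c K $ i \<le> 0"
    "defect c K $ i = 0 \<Longrightarrow> flux c K $ i = 0 \<and> flux c (K - 1) $ i = 0"
proof -
  have "defect c K $ i = - (cell_size_at N X0 K * c0 K $ i) + dt * flux c K $ i - dt * flux c (K - 1) $ i"
    using assms(3) by (simp add: defect_def algebra_simps)
  moreover have "0 \<le> cell_size_at N X0 K * c0 K $ i"
    using c0_nonneg[OF assms(2)] cell_size_old_pos[of K] by simp
  moreover have "dt * flux c K $ i \<le> 0" "0 \<le> dt * flux c (K - 1) $ i"
    using flux_right_at_zero(1)[OF assms] flux_left_at_zero(1)[OF assms] dt_pos
    by (simp_all add: mult_le_0_iff)
  ultimately show "defect c K $ i \<le> 0"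
    "defect c K $ i = 0 \<Longrightarrow> flux c K $ i = 0 \<and> flux c (K - 1) $ i = 0"
    using dt_pos by (linarith, smt (verit) mult_eq_0_iff)
qed

lemma exists_zero_defect:
  obtains c where "c \<in> S" "\<And>K. K \<in> {1..N} \<Longrightarrow> defect c K = 0"
  by (rule quasi_positive_field_has_zero[of "{1..N}" defect, folded S_def])
    (use continuous_on_defect defect_total defect_at_zero(1) in auto)

end

section \<open>A solution: conservation, positivity and dissipation\<close>

locale stefan_solution = stefan_step \<kappa> \<mu> N dt X0 c0
  for \<kappa> :: "phase \<Rightarrow> 'n::finite \<Rightarrow> 'n \<Rightarrow> real" and \<mu> N dt X0 c0 +
  fixes c :: "nat \<Rightarrow> real^'n"
  assumes c_S: "c \<in> S" and zero_defect: "\<And>K. K \<in> {1..N} \<Longrightarrow> defect c K = 0"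
begin

abbreviation "X \<equiv> X_new c"

definition dissipation :: "nat \<Rightarrow> real" where
  "dissipation K = jump (vlog \<circ> c) K \<bullet>
     (M_hat \<kappa> (cell_phase N X0 K) (edge_conc c K) *v jump (vlog \<circ> c) K)"

definition affinity :: "'n \<Rightarrow> real" where
  "affinity i = ln (c (m + 1) $ i) + \<mu> Gas $ i - ln (c m $ i) - \<mu> Solid $ i"

lemma balance:
  assumes "K \<in> {1..N}"
  shows "cell_size N m X K * c K $ i - cell_size_at N X0 K * c0 K $ i
    = - dt * (flux c K $ i - flux c (K - 1) $ i)"
proof -
  have "defect c K $ i = 0"
    using zero_defect[OF assms] by simp
  then show ?thesis by (simp add: defect_def)
qed

lemma gas_matrix_invertible: "invertible (A_shift (\<kappa> Gas) (edge_conc c K))"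
  using edge_conc_nonneg[OF c_S] by (intro mob.A_shift_invertible)

lemma solves_scheme: "scheme_solution \<kappa> \<mu> N dt c0 X0 c X (flux c)"
proof -
  have "1 / dt * (cell_size N m X K * c K $ i - cell_size_at N X0 K * c0 K $ i)
      + flux c K $ i - flux c (K - 1) $ i = 0" if "K \<in> {1..N}" for i K
    unfolding balance[OF that] using dt_pos by simp
  moreover have "h *\<^sub>R flux c K = - (A_hat \<kappa> Solid (edge_conc c K) *v jump c K)"
    if "1 \<le> K \<and> K < m" for K
    using that iface_less h_pos by (simp add: flux_def cell_phase_def)
  moreover have "h *\<^sub>R (A_shift (\<kappa> Gas) (edge_conc c K) *v flux c K) = - jump c K"
    if "m < K \<and> K \<le> N - 1" for K
  proof -
    let ?A = "A_shift (\<kappa> Gas) (edge_conc c K)"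
    have "?A *v (matrix_inv ?A *v jump c K) = jump c K"
      using matrix_inv_mult_right[OF gas_matrix_invertible] by (simp add: matrix_vector_mul_assoc)
    moreover have "flux c K = - (1 / h) *\<^sub>R (matrix_inv ?A *v jump c K)"
      using that N_ge by (auto simp: flux_def cell_phase_def A_hat_def)
    ultimately have "?A *v flux c K = - (1 / h) *\<^sub>R jump c K"
      by (simp only: matrix_vector_mult_scaleR)
    then show ?thesis
      using h_pos by simp
  qed
  moreover have "flux c m = - F c"
    using iface_gt iface_less by (simp add: flux_def)
  ultimately show ?thesis
    using X_new_unit[OF c_S] flux_boundary
    by (simp add: scheme_solution_def Let_def X_new_def[symmetric])
qed

lemma total_balance:
  "(\<Sum>K=1..N. cell_size N m X K * c K $ i) = (\<Sum>K=1..N. cell_size_at N X0 K * c0 K $ i)"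
proof -
  have "(\<Sum>K=1..N. cell_size N m X K * c K $ i) - (\<Sum>K=1..N. cell_size_at N X0 K * c0 K $ i)
      = - dt * (\<Sum>K=1..N. 1 * (flux c K $ i - flux c (K - 1) $ i))"
    unfolding sum_subtractf[symmetric] sum_distrib_left using balance by (intro sum.cong) auto
  also have "\<dots> = 0"
    by (subst summation_by_parts) (simp_all add: flux_boundary)
  finally show ?thesis by simp
qed

text \<open>A zero component at a solution forces the fluxes at both edges of the cell to vanish,
  hence the component vanishes in both neighbouring cells, hence everywhere.\<close>

lemma positive:
  assumes "K \<in> {1..N}"
  shows "0 < c K $ i"
proof (rule ccontr)
  assume "\<not> 0 < c K $ i"
  then have zero: "c K $ i = 0"
    using S_nonneg[OF c_S, of K i] by simp
  have spread: "(L < N \<longrightarrow> c (L + 1) $ i = 0) \<and> (1 < L \<longrightarrow> c (L - 1) $ i = 0)"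
    if "L \<in> {1..N}" "c L $ i = 0" for L
    using defect_at_zero(2)[OF c_S that] zero_defect[OF that(1)]
      flux_right_at_zero(2)[OF c_S that] flux_left_at_zero(2)[OF c_S that] by simp
  have up: "K + d \<le> N \<Longrightarrow> c (K + d) $ i = 0" for d
  proof (induction d)
    case (Suc d)
    then show ?case using spread[of "K + d"] assms by simp
  qed (simp add: zero)
  have down: "1 \<le> K - d \<Longrightarrow> c (K - d) $ i = 0" for d
  proof (induction d)
    case (Suc d)
    then show ?case using spread[of "K - d"] assms by (simp add: Suc_le_eq)
  qed (simp add: zero)
  have "c L $ i = 0" if "L \<in> {1..N}" for L
    using up[of "L - K"] down[of "K - L"] that by (cases "K \<le> L") auto
  then have "(\<Sum>K=1..N. cell_size N m X K * c K $ i) = 0" by simp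
  then show False
    using total_balance[of i] mass_pos[of i] by simp
qed

text \<open>The discrete chain rule for which the logarithmic mean is designed.\<close>

lemma jump_conc:
  assumes "1 \<le> K" "K < N"
  shows "jump c K = (\<chi> i. edge_conc c K $ i * jump (vlog \<circ> c) K $ i)"
proof -
  have "jump c K $ i = edge_conc c K $ i * jump (vlog \<circ> c) K $ i" for i
    using log_mean_times_ln_diff[of "c K $ i" "c (K + 1) $ i"] positive[of K i] positive[of "K + 1" i] assms
    by (simp add: jump_def edge_conc_def vlog_def algebra_simps)
  then show ?thesis by (simp add: vec_eq_iff)
qed

lemma bulk_power:
  assumes "K \<in> {1..N - 1} - {m}"
  shows "jump (vlog \<circ> c) K \<bullet> flux c K = - (1 / h) * dissipation K"
proof -
  have "1 \<le> K" "K < N" "K \<noteq> m" using assms by auto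
  then have "flux c K = - (1 / h) *\<^sub>R (M_hat \<kappa> (cell_phase N X0 K) (edge_conc c K) *v jump (vlog \<circ> c) K)"
    by (simp add: flux_def M_hat_mult_vec jump_conc)
  then show ?thesis by (simp add: dissipation_def)
qed

text \<open>The energy on the left uses the intermediate cell sizes and the old phases.  The
  interface edge is separated from the others in the summation by parts: across it the reference
  potential changes too, which gives the affinity; all other edges have the same phase on both
  sides.\<close>

lemma energy_inequality_before_remeshing:
  "(\<Sum>K=1..N. cell_size N m X K * energy_density \<mu> (cell_phase N X0 K) (c K))
    + dt / h * (\<Sum>K\<in>{1..N - 1} - {m}. dissipation K)
    + dt * (\<Sum>i\<in>UNIV. F c $ i * affinity i) \<le> free_energy \<mu> N c0 X0"
proof -
  define g where "g K i = ln (c K $ i) + \<mu> (cell_phase N X0 K) $ i" for K i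
  define s where "s = cell_size N m X"
  define s\<^sub>0 where "s\<^sub>0 = cell_size_at N X0"
  define T where "T K = (\<Sum>i\<in>UNIV. (g (K + 1) i - g K i) * flux c K $ i)" for K
  have "(\<Sum>K=1..N. s K * energy_density \<mu> (cell_phase N X0 K) (c K)) - free_energy \<mu> N c0 X0
      = (\<Sum>K=1..N. s K * energy_density \<mu> (cell_phase N X0 K) (c K)
          - s\<^sub>0 K * energy_density \<mu> (cell_phase N X0 K) (c0 K))"
    by (simp add: free_energy_def sum_subtractf s\<^sub>0_def)
  also have "\<dots> \<le> (\<Sum>K=1..N. (\<Sum>i\<in>UNIV. g K i * (s K * c K $ i - s\<^sub>0 K * c0 K $ i))
      + (s K - s\<^sub>0 K) * (CARD('n) - 1))"
    unfolding g_def using positive S_total[OF c_S] c0_nonneg cell_size_old_pos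
    by (intro sum_mono energy_density_resized_cell) (auto simp: s\<^sub>0_def less_imp_le)
  \<comment> \<open>The cell sizes have the same sum before and after the motion.\<close>
  also have "\<dots> = (\<Sum>K=1..N. \<Sum>i\<in>UNIV. g K i * (s K * c K $ i - s\<^sub>0 K * c0 K $ i))"
    using sum_cell_size[of X X0]
    by (simp add: sum.distrib sum_distrib_right[symmetric] sum_subtractf s_def s\<^sub>0_def cell_size_at_def)
  also have "\<dots> = (\<Sum>K=1..N. \<Sum>i\<in>UNIV. - dt * (g K i * (flux c K $ i - flux c (K - 1) $ i)))"
    unfolding s_def s\<^sub>0_def by (intro sum.cong refl) (simp add: balance)
  also have "\<dots> = - dt * (\<Sum>i\<in>UNIV. \<Sum>K=1..N. g K i * (flux c K $ i - flux c (K - 1) $ i))"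
    by (subst sum.swap) (simp add: sum_distrib_left)
  also have "\<dots> = - dt * (\<Sum>i\<in>UNIV. - (\<Sum>K\<in>{1..N - 1}. (g (K + 1) i - g K i) * flux c K $ i))"
    by (intro arg_cong[where f = "\<lambda>x. - dt * x"] sum.cong refl summation_by_parts) (simp_all add: flux_boundary)
  also have "\<dots> = dt * (\<Sum>K\<in>{1..N - 1}. T K)"
    unfolding T_def by (subst sum.swap) (simp add: sum_negf)
  also have "(\<Sum>K\<in>{1..N - 1}. T K) = T m + (\<Sum>K\<in>{1..N - 1} - {m}. T K)"
    using iface_gt iface_less by (intro sum.remove) auto
  also have "T m = - (\<Sum>i\<in>UNIV. F c $ i * affinity i)"
    using iface_gt iface_less
    by (simp add: T_def g_def affinity_def flux_def cell_phase_def sum_negf[symmetric] algebra_simps)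
  also have "(\<Sum>K\<in>{1..N - 1} - {m}. T K) = (\<Sum>K\<in>{1..N - 1} - {m}. - (1 / h) * dissipation K)"
  proof (rule sum.cong[OF refl])
    fix K assume K: "K \<in> {1..N - 1} - {m}"
    then have "cell_phase N X0 (K + 1) = cell_phase N X0 K"
      by (auto simp: cell_phase_def)
    then have "T K = jump (vlog \<circ> c) K \<bullet> flux c K"
      by (simp add: T_def g_def inner_vec_def jump_def vlog_def)
    then show "T K = - (1 / h) * dissipation K"
      using bulk_power[OF K] by simp
  qed
  finally show ?thesis
    unfolding s_def sum_distrib_left[symmetric] by (simp add: algebra_simps)
qed

lemma dissipation_nonneg:
  assumes "K \<in> {1..N - 1}"
  shows "0 \<le> dissipation K"
proof -
  have "0 < edge_conc c K $ i" for i
    using positive assms by (auto simp: edge_conc_def intro!: log_mean_pos)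
  then show ?thesis
    by (cases "cell_phase N X0 K")
      (auto simp: dissipation_def M_hat_mult_vec A_hat_def less_imp_le
        intro!: mob.A_shift_diag_nonneg mob.A_shift_inv_diag_nonneg)
qed

text \<open>Both factors compare \<open>\<surd>\<beta> c\<^sub>g\<close> with \<open>c\<^sub>s / \<surd>\<beta>\<close>, the affinity after taking
  logarithms, so they have the same sign.\<close>

lemma interface_power_nonneg: "0 \<le> F c $ i * affinity i"
proof -
  define b x y where "b = sqrt (beta \<mu> i)" and "x = c (m + 1) $ i" and "y = c m $ i"
  have pos: "0 < b" "0 < x" "0 < y"
    using sqrt_beta_pos[of \<mu> i] positive[of "m + 1" i] positive[of m i] iface_gt iface_less
    by (simp_all add: b_def x_def y_def)
  have "ln b = (\<mu> Gas $ i - \<mu> Solid $ i) / 2"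
    by (simp add: b_def ln_sqrt beta_def)
  then have "affinity i = ln (b * x) - ln (1 / b * y)"
    using pos by (simp add: affinity_def x_def y_def ln_mult_pos ln_div)
  moreover have "F c $ i = b * x - 1 / b * y"
    by (simp add: iface_flux_def b_def x_def y_def)
  moreover have "0 < b * x" "0 < 1 / b * y"
    using pos by simp_all
  ultimately show ?thesis
    by (metis (no_types, opaque_lifting) diff_ge_0_iff_ge ln_le_cancel_iff linear mult_nonneg_nonneg mult_nonpos_nonpos diff_le_0_iff_le)
qed

section \<open>Remeshing\<close>

lemma iface_moves_at_most_one:
  obtains "iface N X = m" | "iface N X = m + 1" | "m = iface N X + 1"
proof -
  have "\<bar>real (iface N X) * h - X\<bar> \<le> h / 2"
    using iface_le_and_close[of N X] N_ge X_new_unit[OF c_S] by (simp add: xedge_def)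
  then have "\<bar>real (iface N X) * h - real m * h\<bar> < 2 * h"
    using X_new_close[OF c_S] h_pos by linarith
  then have "\<bar>real (iface N X) - real m\<bar> * h < 2 * h"
    using h_pos by (simp add: left_diff_distrib[symmetric] abs_mult)
  then have "\<bar>real (iface N X) - real m\<bar> < 2"
    using h_pos by simp
  then show thesis using that by linarith
qed

text \<open>If the interface index moves, one intermediate cell is cut by the new mesh into two cells
  of the same phase with equal contents, and the other interface cell is merged with its neighbour
  away from the interface.  Cutting changes neither mass nor energy; merging keeps the mass and
  does not increase the energy, by Jensen's inequality.\<close>

lemma remeshing:
  assumes "1 < iface N X" "iface N X < N"
  obtains c' where "post_processed N X0 X c c'"
    "\<And>i K. K \<in> {1..N} \<Longrightarrow> 0 < c' K $ i"
    "\<And>K. K \<in> {1..N} \<Longrightarrow> (\<Sum>i\<in>UNIV. c' K $ i) = 1"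
    "\<And>i. (\<Sum>K=1..N. cell_size_at N X K * c' K $ i) = (\<Sum>K=1..N. cell_size N m X K * c K $ i)"
    "free_energy \<mu> N c' X
      \<le> (\<Sum>K=1..N. cell_size N m X K * energy_density \<mu> (cell_phase N X0 K) (c K))"
proof -
  define s where "s = cell_size N m X"
  define t where "t = cell_size_at N X"
  have s_pos: "0 < s K" for K
    using cell_size_pos[OF X_new_close[OF c_S]] by (simp add: s_def)
  have total: "(\<Sum>i\<in>UNIV. c K $ i) = 1" for K
    using S_total[OF c_S] .
  show thesis
  proof (rule iface_moves_at_most_one)
    assume same: "iface N X = m"
    show thesis
      by (rule that[of c]) (use same total positive in
          \<open>auto simp: post_processed_def Let_def cell_size_at_def free_energy_def cell_phase_def\<close>)
  next
    assume up: "iface N X = m + 1"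
    have posc: "0 < c K $ i" if "K \<in> {m, m + 1, m + 2}" for K i
      using positive[of K i] that iface_gt up assms(2) by auto
    define v where "v = (1 / (s (m + 1) + h)) *\<^sub>R (s (m + 1) *\<^sub>R c (m + 1) + h *\<^sub>R c (m + 2))"
    define c' where "c' = c(m + 1 := c m, m + 2 := v)"
    have v: "0 < v $ i" "(\<Sum>i\<in>UNIV. v $ i) = 1" "(s (m + 1) + h) * v $ i
        = s (m + 1) * c (m + 1) $ i + h * c (m + 2) $ i" for i
      unfolding v_def using posc total s_pos h_pos by (intro average_in_simplex; simp)+
    have v_energy: "(s (m + 1) + h) * energy_density \<mu> Gas v
        \<le> s (m + 1) * energy_density \<mu> Gas (c (m + 1)) + h * energy_density \<mu> Gas (c (m + 2))"
      unfolding v_def using posc s_pos h_pos by (intro energy_density_average; simp)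
    \<comment> \<open>The new cells \<open>m\<close> and \<open>m + 1\<close> share the enlarged solid cell; the new cell \<open>m + 2\<close> is the
      small gas cell merged with its right neighbour.\<close>
    have sizes: "t m + t (m + 1) = s m" "t (m + 2) = s (m + 1) + h" "s (m + 2) = h"
      using iface_gt by (auto simp: t_def s_def cell_size_at_def cell_size_def up xedge_def algebra_simps of_nat_diff)
    have other: "t K = s K" "c' K = c K" "cell_phase N X K = cell_phase N X0 K"
      if "K \<in> {1..N} - {m, m + 1, m + 2}" for K
      using that by (auto simp: t_def s_def cell_size_at_def cell_size_def up c'_def cell_phase_def)
    have phases: "cell_phase N X m = Solid" "cell_phase N X (m + 1) = Solid" "cell_phase N X (m + 2) = Gas"
      "cell_phase N X0 m = Solid" "cell_phase N X0 (m + 1) = Gas" "cell_phase N X0 (m + 2) = Gas"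
      by (simp_all add: cell_phase_def up)
    have c': "c' m = c m" "c' (m + 1) = c m" "c' (m + 2) = v"
      by (simp_all add: c'_def)
    show thesis
    proof (rule that[of c'])
      show "post_processed N X0 X c c'"
        using up assms(2) by (auto simp: post_processed_def Let_def c'_def v_def s_def add.commute)
      show "0 < c' K $ i" if "K \<in> {1..N}" for K i
        using that v(1) positive iface_gt iface_less by (auto simp: c'_def)
      show "(\<Sum>i\<in>UNIV. c' K $ i) = 1" if "K \<in> {1..N}" for K
        using v(2) total by (auto simp: c'_def)
      show "(\<Sum>K=1..N. cell_size_at N X K * c' K $ i) = (\<Sum>K=1..N. cell_size N m X K * c K $ i)" for i
        unfolding t_def[symmetric] s_def[symmetric]
      proof (rule sum_eq_of_agree_outside_three[of m])
        have "t m * c m $ i + t (m + 1) * c m $ i = s m * c m $ i"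
          using sizes(1) by (metis distrib_right)
        then show "t m * c' m $ i + t (m + 1) * c' (m + 1) $ i + t (m + 2) * c' (m + 2) $ i
            = s m * c m $ i + s (m + 1) * c (m + 1) $ i + s (m + 2) * c (m + 2) $ i"
          unfolding c' sizes(2,3) v(3) by linarith
      qed (use iface_gt up assms(2) other in auto)
      show "free_energy \<mu> N c' X
          \<le> (\<Sum>K=1..N. cell_size N m X K * energy_density \<mu> (cell_phase N X0 K) (c K))"
        unfolding free_energy_def t_def[symmetric] s_def[symmetric]
      proof (rule sum_le_of_agree_outside_three[of m])
        let ?e = "energy_density \<mu> Solid (c m)"
        have "t m * ?e + t (m + 1) * ?e = s m * ?e"
          using sizes(1) by (metis distrib_right)
        then show "t m * energy_density \<mu> (cell_phase N X m) (c' m)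
            + t (m + 1) * energy_density \<mu> (cell_phase N X (m + 1)) (c' (m + 1))
            + t (m + 2) * energy_density \<mu> (cell_phase N X (m + 2)) (c' (m + 2))
            \<le> s m * energy_density \<mu> (cell_phase N X0 m) (c m)
              + s (m + 1) * energy_density \<mu> (cell_phase N X0 (m + 1)) (c (m + 1))
              + s (m + 2) * energy_density \<mu> (cell_phase N X0 (m + 2)) (c (m + 2))"
          unfolding c' phases sizes(2,3) using v_energy by linarith
      qed (use iface_gt up assms(2) other in auto)
    qed
  next
    assume down: "m = iface N X + 1"
    define l where "l = iface N X"
    have m: "m = l + 1" and l: "1 < l" "l + 2 \<le> N"
      using down assms iface_less by (simp_all add: l_def)
    have posc: "0 < c K $ i" if "K \<in> {l, l + 1, l + 2}" for K i
      using positive[of K i] that l by auto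
    define v where "v = (1 / (h + s (l + 1))) *\<^sub>R (h *\<^sub>R c l + s (l + 1) *\<^sub>R c (l + 1))"
    define c' where "c' = c(l + 1 := c (l + 2), l := v)"
    have v: "0 < v $ i" "(\<Sum>i\<in>UNIV. v $ i) = 1" "(h + s (l + 1)) * v $ i
        = h * c l $ i + s (l + 1) * c (l + 1) $ i" for i
      unfolding v_def using posc total s_pos h_pos by (intro average_in_simplex; simp)+
    have v_energy: "(h + s (l + 1)) * energy_density \<mu> Solid v
        \<le> h * energy_density \<mu> Solid (c l) + s (l + 1) * energy_density \<mu> Solid (c (l + 1))"
      unfolding v_def using posc s_pos h_pos by (intro energy_density_average; simp)
    \<comment> \<open>The new cells \<open>l + 1\<close> and \<open>l + 2\<close> share the enlarged gas cell; the new cell \<open>l\<close> is the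
      small solid cell merged with its left neighbour.\<close>
    have sizes: "t (l + 1) + t (l + 2) = s (l + 2)" "t l = h + s (l + 1)" "s l = h"
      using l by (auto simp: t_def s_def cell_size_at_def cell_size_def l_def[symmetric] m xedge_def
          algebra_simps of_nat_diff)
    have other: "t K = s K" "c' K = c K" "cell_phase N X K = cell_phase N X0 K"
      if "K \<in> {1..N} - {l, l + 1, l + 2}" for K
      using that by (auto simp: t_def s_def cell_size_at_def cell_size_def l_def[symmetric] m c'_def cell_phase_def)
    have phases: "cell_phase N X l = Solid" "cell_phase N X (l + 1) = Gas" "cell_phase N X (l + 2) = Gas"
      "cell_phase N X0 l = Solid" "cell_phase N X0 (l + 1) = Solid" "cell_phase N X0 (l + 2) = Gas"
      by (simp_all add: cell_phase_def l_def[symmetric] m)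
    have c': "c' l = v" "c' (l + 1) = c (l + 2)" "c' (l + 2) = c (l + 2)"
      by (simp_all add: c'_def)
    show thesis
    proof (rule that[of c'])
      show "post_processed N X0 X c c'"
        using l by (auto simp: post_processed_def Let_def l_def[symmetric] m c'_def v_def s_def)
      show "0 < c' K $ i" if "K \<in> {1..N}" for K i
        using that v(1) positive l by (auto simp: c'_def)
      show "(\<Sum>i\<in>UNIV. c' K $ i) = 1" if "K \<in> {1..N}" for K
        using v(2) total by (auto simp: c'_def)
      show "(\<Sum>K=1..N. cell_size_at N X K * c' K $ i) = (\<Sum>K=1..N. cell_size N m X K * c K $ i)" for i
        unfolding t_def[symmetric] s_def[symmetric]
      proof (rule sum_eq_of_agree_outside_three[of l])
        have "t (l + 1) * c (l + 2) $ i + t (l + 2) * c (l + 2) $ i = s (l + 2) * c (l + 2) $ i"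
          using sizes(1) by (metis distrib_right)
        then show "t l * c' l $ i + t (l + 1) * c' (l + 1) $ i + t (l + 2) * c' (l + 2) $ i
            = s l * c l $ i + s (l + 1) * c (l + 1) $ i + s (l + 2) * c (l + 2) $ i"
          unfolding c' sizes(2,3) v(3) by linarith
      qed (use l other in auto)
      show "free_energy \<mu> N c' X
          \<le> (\<Sum>K=1..N. cell_size N m X K * energy_density \<mu> (cell_phase N X0 K) (c K))"
        unfolding free_energy_def t_def[symmetric] s_def[symmetric]
      proof (rule sum_le_of_agree_outside_three[of l])
        let ?e = "energy_density \<mu> Gas (c (l + 2))"
        have "t (l + 1) * ?e + t (l + 2) * ?e = s (l + 2) * ?e"
          using sizes(1) by (metis distrib_right)
        then show "t l * energy_density \<mu> (cell_phase N X l) (c' l)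
            + t (l + 1) * energy_density \<mu> (cell_phase N X (l + 1)) (c' (l + 1))
            + t (l + 2) * energy_density \<mu> (cell_phase N X (l + 2)) (c' (l + 2))
            \<le> s l * energy_density \<mu> (cell_phase N X0 l) (c l)
              + s (l + 1) * energy_density \<mu> (cell_phase N X0 (l + 1)) (c (l + 1))
              + s (l + 2) * energy_density \<mu> (cell_phase N X0 (l + 2)) (c (l + 2))"
          unfolding c' phases sizes(2,3) using v_energy by linarith
      qed (use l other in auto)
    qed
  qed
qed

end

section \<open>Existence of a dissipative solution\<close>

theorem theorem1:
  fixes \<kappa> :: "phase \<Rightarrow> 'n::finite \<Rightarrow> 'n \<Rightarrow> real"
    and \<mu> :: "phase \<Rightarrow> real^'n"
    and N :: nat and dt X0 :: real
    and c0 :: "nat \<Rightarrow> real^'n"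
  assumes "CARD('n) \<ge> 2"
    and "\<And>\<alpha> i j. i \<noteq> j \<Longrightarrow> \<kappa> \<alpha> i j = \<kappa> \<alpha> j i"
    and "\<And>\<alpha> i j. i \<noteq> j \<Longrightarrow> \<kappa> \<alpha> i j > 0"
    and "N \<ge> 1"
    and "0 < dt" and "dt < dx N / (2 * speed_bound \<mu>)"
    and "\<And>i K. K \<in> {1..N} \<Longrightarrow> c0 K $ i \<ge> 0"
    and "\<And>K. K \<in> {1..N} \<Longrightarrow> (\<Sum>i\<in>UNIV. c0 K $ i) = 1"
    and "X0 \<in> {0..1}"
    and "1 < iface N X0" and "iface N X0 < N"
    and "\<And>i. (\<Sum>K=1..N. cell_size_at N X0 K * c0 K $ i) > 0"
  shows "\<exists>cs X J. scheme_solution \<kappa> \<mu> N dt c0 X0 cs X J \<and>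
    (let m = iface N X0; F = iface_flux \<mu> m cs in
      (\<forall>K\<in>{1..N}. diamond (cs K) = cs K) \<and>
      (\<Sum>i\<in>UNIV. cs m $ i) *\<^sub>R F = (\<Sum>i\<in>UNIV. cs (m + 1) $ i) *\<^sub>R F \<and>
      (\<forall>K. m < K \<and> K \<le> N - 1 \<longrightarrow> invertible (A_shift (\<kappa> Gas) (edge_conc cs K))) \<and>
      (\<forall>i. \<forall>K\<in>{1..N}. cs K $ i > 0) \<and>
      (1 < iface N X \<and> iface N X < N \<longrightarrow>
        (\<exists>c. post_processed N X0 X cs c \<and>
          (\<forall>i. \<forall>K\<in>{1..N}. c K $ i > 0) \<and>
          (\<forall>K\<in>{1..N}. (\<Sum>i\<in>UNIV. c K $ i) = 1) \<and>
          (\<forall>i. (\<Sum>K=1..N. cell_size_at N X K * c K $ i)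
                = (\<Sum>K=1..N. cell_size_at N X0 K * c0 K $ i)) \<and>
          free_energy \<mu> N c X
            + dt / dx N * (\<Sum>K\<in>{1..N - 1} - {m}.
                jump (vlog \<circ> cs) K \<bullet>
                  (M_hat \<kappa> (cell_phase N X0 K) (edge_conc cs K) *v jump (vlog \<circ> cs) K))
            + dt * (\<Sum>i\<in>UNIV. F $ i * (ln (cs (m + 1) $ i) + \<mu> Gas $ i
                                      - ln (cs m $ i) - \<mu> Solid $ i))
            \<le> free_energy \<mu> N c0 X0 \<and>
          free_energy \<mu> N c X \<le> free_energy \<mu> N c0 X0)))"
proof -
  interpret stefan_step \<kappa> \<mu> N dt X0 c0
    using assms by unfold_locales
  obtain cs where cs: "cs \<in> S" "\<And>K. K \<in> {1..N} \<Longrightarrow> defect cs K = 0"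
    using exists_zero_defect by blast
  interpret stefan_solution \<kappa> \<mu> N dt X0 c0 cs
    using cs by unfold_locales
  have diamond: "diamond (cs K) = cs K" for K
    using S_nonneg[OF c_S] S_total[OF c_S] by (simp add: diamond_def vec_eq_iff max_absorb1)
  have equal_totals: "(\<Sum>i\<in>UNIV. cs m $ i) = (\<Sum>i\<in>UNIV. cs (m + 1) $ i)"
    by (simp add: S_total[OF c_S])
  have "0 \<le> (\<Sum>K\<in>{1..N - 1} - {m}. dissipation K)"
    by (intro sum_nonneg dissipation_nonneg) auto
  moreover have "0 \<le> (\<Sum>i\<in>UNIV. F cs $ i * affinity i)"
    by (intro sum_nonneg interface_power_nonneg)
  ultimately have dissipative: "0 \<le> dt / h * (\<Sum>K\<in>{1..N - 1} - {m}. dissipation K)"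
    "0 \<le> dt * (\<Sum>i\<in>UNIV. F cs $ i * affinity i)"
    using dt_pos h_pos by simp_all
  have remeshed: "\<exists>c. post_processed N X0 X cs c \<and> (\<forall>i. \<forall>K\<in>{1..N}. c K $ i > 0) \<and>
      (\<forall>K\<in>{1..N}. (\<Sum>i\<in>UNIV. c K $ i) = 1) \<and>
      (\<forall>i. (\<Sum>K=1..N. cell_size_at N X K * c K $ i) = (\<Sum>K=1..N. cell_size_at N X0 K * c0 K $ i)) \<and>
      free_energy \<mu> N c X + dt / h * (\<Sum>K\<in>{1..N - 1} - {m}. dissipation K)
        + dt * (\<Sum>i\<in>UNIV. F cs $ i * affinity i) \<le> free_energy \<mu> N c0 X0 \<and>
      free_energy \<mu> N c X \<le> free_energy \<mu> N c0 X0" if inner: "1 < iface N X \<and> iface N X < N"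
  proof -
    obtain c where c: "post_processed N X0 X cs c" "\<And>i K. K \<in> {1..N} \<Longrightarrow> 0 < c K $ i"
      "\<And>K. K \<in> {1..N} \<Longrightarrow> (\<Sum>i\<in>UNIV. c K $ i) = 1"
      "\<And>i. (\<Sum>K=1..N. cell_size_at N X K * c K $ i) = (\<Sum>K=1..N. cell_size N m X K * cs K $ i)"
      and energy: "free_energy \<mu> N c X
        \<le> (\<Sum>K=1..N. cell_size N m X K * energy_density \<mu> (cell_phase N X0 K) (cs K))"
      by (rule remeshing[OF conjunct1[OF inner] conjunct2[OF inner]], rule that)
    have "free_energy \<mu> N c X + dt / h * (\<Sum>K\<in>{1..N - 1} - {m}. dissipation K)
        + dt * (\<Sum>i\<in>UNIV. F cs $ i * affinity i) \<le> free_energy \<mu> N c0 X0"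
      using energy energy_inequality_before_remeshing by linarith
    moreover from this have "free_energy \<mu> N c X \<le> free_energy \<mu> N c0 X0"
      using dissipative by linarith
    ultimately show ?thesis
      using c total_balance by (intro exI[of _ c] conjI allI ballI) simp_all
  qed
  show ?thesis
    unfolding Let_def
  proof (rule exI[of _ cs], rule exI[of _ X], rule exI[of _ "flux cs"], intro conjI ballI allI impI)
    show "(\<Sum>i\<in>UNIV. cs m $ i) *\<^sub>R F cs = (\<Sum>i\<in>UNIV. cs (m + 1) $ i) *\<^sub>R F cs"
      by (simp only: equal_totals)
  qed (rule solves_scheme diamond gas_matrix_invertible positive
      remeshed[unfolded dissipation_def affinity_def]; assumption)+
qed

end
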